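(* A sample of $B\breve\theta$ can be computed as $\Gamma\,\nu_z$ where $\nu_z\sim\mathcal N(0,W_z^{-1})$; that is, the random vectors $B\breve\theta$ and $\Gamma\nu_z$ in $\mathbb{R}^n$ have the same distribution, where $$\Gamma=\sqrt{\nabla_uJ\,W_u^{-1}\,\nabla_uJ^T}\,\left(I_n-W_z^{-1}Z_c\left(Z_c^TW_z^{-1}Z_c\right)^{-1}Z_c^T\right)\in\mathbb{R}^{n\times n},$$ $Z_c=\begin{pmatrix} z_2-\tilde z&\cdots&z_N-\tilde z\end{pmatrix}\in\mathbb{R}^{n\times(N-1)}$, and $\nabla_uJ$ is evaluated at $(\tilde S(\tilde z),\tilde z)$.
   Context: Let $m,n,N$ be positive integers and $p=m(n+1)$. Let $M_z\in\mathbb{R}^{n\times n}$, $W_u\in\mathbb{R}^{m\times m}$ and $W_z\in\mathbb{R}^{n\times n}$ be symmetric positive definite, and let $W_z^{-1/2}$ be the symmetric positive definite square root of $W_z^{-1}$. $I_k$ is the $k\times k$ identity, $\otimes$ is the Kronecker product, and $\mathcal N(0,C)$ denotes the Gaussian distribution with mean $0$ and covariance $C$. Let $J:\mathbb{R}^m\times\mathbb{R}^n\to\mathbb{R}$, $(u,z)\mapsto J(u,z)$, be the objective function and $\tilde S:\mathbb{R}^n\to\mathbb{R}^m$ the low-fidelity solution operator. The model discrepancy is $\delta(z,\theta)=\begin{pmatrix} I_m & I_m\otimes z^TM_z\end{pmatrix}\theta\in\mathbb{R}^m$ for $z\in\mathbb{R}^n$, $\theta\in\mathbb{R}^p$, and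 $\mathcal J(z,\theta)=J(\tilde S(z)+\delta(z,\theta),z)$, which is assumed twice continuously differentiable (the derivatives of $J$ and $\tilde S$ appearing below are assumed to exist). Assume $\nabla_{z,u}J=0$. The point $\tilde z\in\mathbb{R}^n$ is a local minimum of $\mathcal J(\cdot,0)$ with $\nabla_z\mathcal J(\tilde z,0)=0$ and $\nabla_{z,z}\mathcal J(\tilde z,0)$ positive definite. Gradients are row vectors. The matrix $B=\nabla_{z,\theta}\mathcal J(\tilde z,0)$ is $$B=\nabla_z\tilde S^T\,\nabla_{u,u}J\begin{pmatrix} I_m & I_m\otimes\tilde z^TM_z\end{pmatrix}+\begin{pmatrix} 0 & \nabla_uJ\otimes M_z\end{pmatrix}\in\mathbb{R}^{n\times p},$$ where $\nabla_z\tilde S\in\mathbb{R}^{m\times n}$ (Jacobian) is evaluated at $\tilde z$, and $\nabla_uJ\in\mathbb{R}^{1\times m}$ and $\nabla_{u,u}J\in\mathbb{R}^{m\times m}$ (Hessian in $u$) are evaluated at $(\tilde S(\tilde z),\tilde z)$. Let $z_1,\dots,z_N\in\mathbb{R}^n$ be linearly independent with $z_1=\tilde z$. If $N=1$, $Z_c$ is empty and the term containing $Z_c$ is absent. Let $\{\breve z_1,\dots,\breve z_{n-N+1}\}\subset\mathbb{R}^n$ be an orthonormal set (Euclidean inner product) of vectors orthogonal to $\{W_z^{-1/2}(z_\ell-\tilde z)\}_{\ell=2}^N$, let $\breve u_1,\dots,\breve u_{n-N+1}\sim\mathcal N(0,W_u^{-1})$ be independent, and define $$\breve\theta=\sum_{k=1}^{n-N+1}\begin{pmatrix}\breve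 s_k\,\breve u_k\\ \breve u_k\otimes\breve y_k\end{pmatrix}\in\mathbb{R}^p,\qquad \breve s_k=-\tilde z^TW_z^{-1/2}\breve z_k,\quad \breve y_k=M_z^{-1}W_z^{-1/2}\breve z_k .$$ *)

theory Defs
  imports "HOL-Probability.Probability"
begin

section \<open>Matrices and block vectors\<close>

definition pos_def :: "real^'n^'n \<Rightarrow> bool" where
  "pos_def A \<longleftrightarrow> (\<forall>x. x \<noteq> 0 \<longrightarrow> x \<bullet> (A *v x) > 0)"

definition spd :: "real^'n^'n \<Rightarrow> bool" where
  "spd A \<longleftrightarrow> transpose A = A \<and> pos_def A"

text \<open>Rows and columns of a Kronecker product are indexed by pairs, the first component being
  the block number.  The parameter space of dimension \<open>m (n + 1) = m + m n\<close> is
  \<open>real^('m + 'm \<times> 'n)\<close>: \<open>Inl i\<close> indexes the leading \<open>m\<close> coordinates, and \<open>Inr (j, l)\<close> is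
  position \<open>l\<close> in the \<open>j\<close>-th of the \<open>m\<close> trailing blocks of length \<open>n\<close>.\<close>

definition kron :: "real^'b^'a \<Rightarrow> real^'d^'c \<Rightarrow> real^('b \<times> 'd)^('a \<times> 'c)" where
  "kron A B = (\<chi> p q. A $ fst p $ fst q * B $ snd p $ snd q)"

text \<open>Kronecker products with a row or column vector as a factor; the trivial component of the
  index pairs is dropped.\<close>

definition kron_mat_row :: "real^'b^'a \<Rightarrow> real^'d \<Rightarrow> real^('b \<times> 'd)^'a" where
  "kron_mat_row A r = (\<chi> i. kron A (rowvector r :: real^'d^1) $ (i, 1))"

definition kron_row_mat :: "real^'b \<Rightarrow> real^'d^'c \<Rightarrow> real^('b \<times> 'd)^'c" where
  "kron_row_mat r A = (\<chi> i. kron (rowvector r :: real^'b^1) A $ (1, i))"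

definition kron_col_col :: "real^'a \<Rightarrow> real^'c \<Rightarrow> real^('a \<times> 'c)" where
  "kron_col_col u y =
     (\<chi> p. kron (columnvector u :: real^1^'a) (columnvector y :: real^1^'c) $ p $ (1, 1))"

definition stack :: "real^'a \<Rightarrow> real^'b \<Rightarrow> real^('a + 'b)" where
  "stack x y = (\<chi> c. case c of Inl a \<Rightarrow> x $ a | Inr b \<Rightarrow> y $ b)"

definition hblock :: "real^'a^'c \<Rightarrow> real^'b^'c \<Rightarrow> real^('a + 'b)^'c" where
  "hblock A B = (\<chi> i. stack (A $ i) (B $ i))"

section \<open>Derivatives\<close>

definition gradient :: "('a::real_inner \<Rightarrow> real) \<Rightarrow> 'a \<Rightarrow> 'a" where
  "gradient f x = (THE D. GDERIV f x :> D)"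

text \<open>The entry \<open>(i, k)\<close> of \<open>mixed_hessian f x y\<close> is the second partial derivative
  of \<open>f\<close> with respect to \<open>x\<^sub>i\<close> and \<open>y\<^sub>k\<close>, with the derivative in \<open>y\<close> taken first.\<close>

definition mixed_hessian :: "(real^'n \<Rightarrow> real^'p \<Rightarrow> real) \<Rightarrow> real^'n \<Rightarrow> real^'p \<Rightarrow> real^'p^'n" where
  "mixed_hessian f x y = transpose (jacobian (\<lambda>x'. gradient (f x') y) (at x))"

definition hessian :: "(real^'n \<Rightarrow> real) \<Rightarrow> real^'n \<Rightarrow> real^'n^'n" where
  "hessian f x = transpose (jacobian (gradient f) (at x))"

definition twice_continuously_differentiable :: "('a::real_normed_vector \<Rightarrow> real) \<Rightarrow> bool" where
  "twice_continuously_differentiable f \<longleftrightarrow>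
     (\<exists>(f' :: 'a \<Rightarrow> 'a \<Rightarrow>\<^sub>L real) (f'' :: 'a \<Rightarrow> 'a \<Rightarrow>\<^sub>L ('a \<Rightarrow>\<^sub>L real)).
        (\<forall>x. (f has_derivative blinfun_apply (f' x)) (at x)) \<and>
        (\<forall>x. (f' has_derivative blinfun_apply (f'' x)) (at x)) \<and>
        continuous_on UNIV f'')"

section \<open>Gaussian distributions\<close>

text \<open>Density of the centred Gaussian distribution with (symmetric positive definite)
  covariance matrix \<open>C\<close>.\<close>

definition gaussian_density :: "real^'n^'n \<Rightarrow> real^'n \<Rightarrow> real" where
  "gaussian_density C x =
     exp (- (x \<bullet> (matrix_inv C *v x)) / 2) / sqrt ((2 * pi) ^ CARD('n) * det C)"

definition gaussian_distributed :: "'a measure \<Rightarrow> ('a \<Rightarrow> real^'n) \<Rightarrow> real^'n^'n \<Rightarrow> bool" where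
  "gaussian_distributed M X C \<longleftrightarrow>
     distributed M lborel X (\<lambda>x. ennreal (gaussian_density C x))"

section \<open>The optimization problem with model discrepancy\<close>

definition discrepancy_matrix :: "real^'n^'n \<Rightarrow> real^'n \<Rightarrow> real^('m + 'm \<times> 'n)^'m" where
  "discrepancy_matrix Mz z = hblock (mat 1) (kron_mat_row (mat 1) (z v* Mz))"

definition discrepancy :: "real^'n^'n \<Rightarrow> real^'n \<Rightarrow> real^('m + 'm \<times> 'n) \<Rightarrow> real^'m" where
  "discrepancy Mz z \<theta> = discrepancy_matrix Mz z *v \<theta>"

definition reduced_objective ::
  "(real^'m \<Rightarrow> real^'n \<Rightarrow> real) \<Rightarrow> (real^'n \<Rightarrow> real^'m) \<Rightarrow> real^'n^'n \<Rightarrow>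
   real^'n \<Rightarrow> real^('m + 'm \<times> 'n) \<Rightarrow> real" where
  "reduced_objective J S Mz z \<theta> = J (S z + discrepancy Mz z \<theta>) z"

definition grad_u :: "(real^'m \<Rightarrow> real^'n \<Rightarrow> real) \<Rightarrow> real^'m \<Rightarrow> real^'n \<Rightarrow> real^'m" where
  "grad_u J u z = gradient (\<lambda>u'. J u' z) u"

text \<open>The parameter sample built from \<open>u\<^sub>1, \<dots>, u\<^sub>K\<close> (\<open>ub\<close>) and the orthonormal vectors \<open>zb\<close>;
  \<open>R\<close> plays the role of the square root of \<open>W\<^sub>z\<^sup>-\<^sup>1\<close>.\<close>

definition theta_sample ::
  "real^'n^'n \<Rightarrow> real^'n^'n \<Rightarrow> real^'n \<Rightarrow> nat \<Rightarrow> (nat \<Rightarrow> real^'n) \<Rightarrow> (nat \<Rightarrow> real^'m) \<Rightarrow>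
   real^('m + 'm \<times> 'n)" where
  "theta_sample Mz R zt K zb ub =
     (\<Sum>k = 1..K.
        let s = - (zt \<bullet> (R *v zb k));
            y = matrix_inv Mz *v (R *v zb k)
        in stack (s *\<^sub>R ub k) (kron_col_col (ub k) y))"

text \<open>\<open>g\<close> plays the role of the gradient of \<open>J\<close> in \<open>u\<close>.  A matrix type has at least one column,
  so for \<open>N = 1\<close>, where the matrix \<open>Zc\<close> of the differences \<open>z\<^sub>l - z\<^sub>1\<close> is empty, its type and
  value are irrelevant.\<close>

definition Gamma_matrix ::
  "nat \<Rightarrow> real^'m \<Rightarrow> real^'m^'m \<Rightarrow> real^'n^'n \<Rightarrow> real^'k^'n \<Rightarrow> real^'n^'n" where
  "Gamma_matrix N g Wu Wz Zc =
     sqrt (g \<bullet> (matrix_inv Wu *v g)) *\<^sub>R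
     (if N = 1 then mat 1
      else mat 1 - matrix_inv Wz ** Zc **
             matrix_inv (transpose Zc ** matrix_inv Wz ** Zc) ** transpose Zc)"

section \<open>The mixed second derivative of the reduced objective\<close>

lemma gradient_eqI: "GDERIV f x :> D \<Longrightarrow> gradient f x = D"
  unfolding gradient_def gderiv_def
  apply (rule the_equality, assumption)
  by (metis (no_types, lifting) ext has_derivative_unique inner_commute vector_eq_ldot)

lemma GDERIV_linear_vec:
  fixes L :: "real^'k \<Rightarrow> real"
  assumes "(f has_derivative L) (at x)"
  shows "GDERIV f x :> (\<chi> j. L (axis j 1))"
proof -
  have "linear L" using assms by (rule has_derivative_linear)
  have "L h = h \<bullet> (\<chi> j. L (axis j 1))" for h
  proof -
    have "L h = L (\<Sum>j\<in>UNIV. h $ j *\<^sub>R axis j 1)"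
      by (metis basis_expansion scalar_mult_eq_scaleR)
    also have "\<dots> = (\<Sum>j\<in>UNIV. h $ j * L (axis j 1))"
      using \<open>linear L\<close> by (simp add: linear_sum linear_scale)
    finally show ?thesis by (simp add: inner_vec_def)
  qed
  hence "L = (\<lambda>h. h \<bullet> (\<chi> j. L (axis j 1)))" by blast
  with assms show ?thesis unfolding gderiv_def by metis
qed

lemma sum_UNIV_Plus:
  fixes g :: "'a::finite + 'b::finite \<Rightarrow> real"
  shows "(\<Sum>c\<in>UNIV. g c) = (\<Sum>a\<in>UNIV. g (Inl a)) + (\<Sum>b\<in>UNIV. g (Inr b))"
  unfolding UNIV_Plus_UNIV[symmetric] by (subst sum.Plus) auto

lemma discrepancy_stack_0: "discrepancy Mz z (stack v 0) = v"
  unfolding discrepancy_def discrepancy_matrix_def hblock_def stack_def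
  by (simp add: vec_eq_iff matrix_vector_mult_def sum_UNIV_Plus mat_def if_distrib[where f="\<lambda>x. x * _"] cong: if_cong)

lemma discrepancy_0: "discrepancy Mz z 0 = 0"
  by (simp add: discrepancy_def)

lemma linear_stack_0: "bounded_linear (\<lambda>v. stack v (0::real^'b::finite) :: real^('a::finite+'b::finite))"
  by (rule linear_conv_bounded_linear[THEN iffD1], rule linearI)
     (auto simp: stack_def vec_eq_iff split: sum.split)

lemma matrix_of_has_derivative: "(f has_derivative L) (at x) \<Longrightarrow> jacobian f (at x) = matrix L"
  by (metis frechet_derivative_at jacobian_def)

text \<open>The matrix \<open>B = mixed_hessian (reduced_objective J S Mz) zt 0\<close> in closed form.\<close>

lemma mixed_hessian_reduced_objective:
  fixes J :: "real^'m \<Rightarrow> real^'n \<Rightarrow> real" and S :: "real^'n \<Rightarrow> real^'m" and zt :: "real^'n"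
  assumes C2: "twice_continuously_differentiable (\<lambda>(z, \<theta>). reduced_objective J S Mz z \<theta>)"
    and S: "S differentiable (at zt)"
    and mixed: "mixed_hessian (\<lambda>z' u'. J u' z') zt (S zt) = 0"
  shows "mixed_hessian (reduced_objective J S Mz) zt 0 =
           transpose (jacobian S (at zt)) ** hessian (\<lambda>u. J u zt) (S zt) ** discrepancy_matrix Mz zt
           + hblock 0 (kron_row_mat (grad_u J (S zt) zt) Mz)"
proof -
  define E where "E = (\<lambda>v::real^'m. stack v 0 :: real^('m + 'm \<times> 'n))"
  define f where "f = reduced_objective J S Mz"
  note [derivative_intros] = bounded_linear.has_derivative[OF linear_stack_0]
  obtain F' F'' where F': "\<And>x. ((\<lambda>(z, \<theta>). f z \<theta>) has_derivative blinfun_apply (F' x)) (at x)"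
    and F'': "\<And>x. (F' has_derivative blinfun_apply (F'' x)) (at x)"
    using C2 unfolding twice_continuously_differentiable_def f_def by metis
  have J_f: "J u z = f z (E (u - S z))" for u z
    by (simp add: f_def reduced_objective_def E_def discrepancy_stack_0)
  define q where "q = (\<lambda>(z, v). \<chi> j. blinfun_apply (F' (z, E v)) (0, E (axis j 1)))"
  have J_deriv: "((\<lambda>u. J u z) has_derivative (\<lambda>h. F' (z, E (u - S z)) (0, E h))) (at u)" for u z
  proof -
    have "((\<lambda>u. (z, E (u - S z))) has_derivative (\<lambda>h. (0, E h))) (at u)"
      unfolding E_def by (auto intro!: derivative_eq_intros)
    from has_derivative_compose[OF this F'] show ?thesis by (simp add: J_f)
  qed
  have G: "GDERIV (\<lambda>u. J u z) u :> q (z, u - S z)" for u z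
    using GDERIV_linear_vec[OF J_deriv] by (simp add: q_def)
  have grad_q: "grad_u J u z = q (z, u - S z)" for u z
    unfolding grad_u_def by (rule gradient_eqI[OF G])
  have q_diff: "q differentiable at x" for x
  proof (subst differentiable_componentwise_within, rule ballI)
    fix b :: "real^'m" assume "b \<in> Basis"
    then obtain j where b: "b = axis j 1" by (auto simp: Basis_vec_def)
    have "((\<lambda>x. blinfun_apply (F' (fst x, E (snd x))) (0, E (axis j 1))) has_derivative 
       (\<lambda>h. blinfun_apply (blinfun_apply (F'' (fst x, E (snd x))) (fst h, E (snd h))) (0, E (axis j 1)))) (at x)"
    proof (rule bounded_linear.has_derivative[OF blinfun.bounded_linear_left])
      have "((\<lambda>x. (fst x, E (snd x))) has_derivative (\<lambda>h. (fst h, E (snd h)))) (at x)"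
        unfolding E_def by (auto intro!: derivative_eq_intros)
      from has_derivative_compose[OF this F'']
      show "((\<lambda>x. F' (fst x, E (snd x))) has_derivative (\<lambda>h. F'' (fst x, E (snd x)) (fst h, E (snd h)))) (at x)" .
    qed
    thus "(\<lambda>x. q x \<bullet> b) differentiable at x"
      unfolding b q_def by (auto simp: inner_axis differentiable_def case_prod_beta)
  qed
  obtain K where K: "((\<lambda>(u, z). grad_u J u z) has_derivative K) (at (S zt, zt))"
  proof -
    obtain S' where S': "(S has_derivative S') (at zt)" using S by (auto simp: differentiable_def)
    obtain Q where Q: "(q has_derivative Q) (at (zt, 0))" using q_diff by (auto simp: differentiable_def)
    have S2: "((\<lambda>x. S (snd x)) has_derivative (\<lambda>h. S' (snd h))) (at (S zt, zt))"
      apply (rule has_derivative_compose[of snd _ "(S zt, zt)" UNIV S, simplified])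
      using S' by (auto intro!: derivative_eq_intros)
    have "((\<lambda>x. (snd x, fst x - S (snd x))) has_derivative (\<lambda>h. (snd h, fst h - S' (snd h)))) (at (S zt, zt))"
      by (rule derivative_eq_intros refl S2)+
    from has_derivative_compose[OF this, of q Q] Q
    have "((\<lambda>x. q (snd x, fst x - S (snd x))) has_derivative (\<lambda>h. Q (snd h, fst h - S' (snd h)))) (at (S zt, zt))"
      by simp
    thus ?thesis by (intro that[of "\<lambda>h. Q (snd h, fst h - S' (snd h))"]) (simp add: grad_q case_prod_unfold)
  qed
  have linK: "linear K" using K by (rule has_derivative_linear)
  let ?H = "hessian (\<lambda>u. J u zt) (S zt)"
  have K1: "K (h, 0) = transpose ?H *v h" for h
  proof -
    have "((\<lambda>u. grad_u J u zt) has_derivative (\<lambda>h. K (h, 0))) (at (S zt))"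
    proof -
      have "((\<lambda>u. (u, zt)) has_derivative (\<lambda>h. (h, 0))) (at (S zt))"
        by (auto intro!: derivative_eq_intros)
      from has_derivative_compose[OF this K] show ?thesis by simp
    qed
    hence "jacobian (gradient (\<lambda>u. J u zt)) (at (S zt)) = matrix (\<lambda>h. K (h, 0))" 
      and "linear (\<lambda>h. K (h, 0))"
      by (auto dest: matrix_of_has_derivative has_derivative_linear simp: grad_u_def)
    thus ?thesis using fun_cong[OF matrix_vector_mul(2), of "\<lambda>h. K (h, 0)" h] by (simp add: hessian_def)
  qed
  have K2: "K (0, h) = 0" for h
  proof -
    have "((\<lambda>z. grad_u J (S zt) z) has_derivative (\<lambda>h. K (0, h))) (at zt)"
    proof -
      have "((\<lambda>z. (S zt, z)) has_derivative (\<lambda>h. (0, h))) (at zt)"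
        by (auto intro!: derivative_eq_intros)
      from has_derivative_compose[OF this K] show ?thesis by simp
    qed
    hence "jacobian (\<lambda>z. gradient (\<lambda>u'. J u' z) (S zt)) (at zt) = matrix (\<lambda>h. K (0, h))"
      and l: "linear (\<lambda>h. K (0, h))"
      by (auto dest: matrix_of_has_derivative has_derivative_linear simp: grad_u_def)
    hence "transpose (matrix (\<lambda>h. K (0, h))) = 0" using mixed by (simp add: mixed_hessian_def)
    hence "matrix (\<lambda>h. K (0, h)) = 0" by (simp add: vec_eq_iff transpose_def)
    with fun_cong[OF matrix_vector_mul(2)[OF l], of h] show ?thesis by simp
  qed
  let ?S' = "jacobian S (at zt)"
  have S': "(S has_derivative (\<lambda>h. ?S' *v h)) (at zt)" using S jacobian_works by blast
  define g where "g = (\<lambda>z. grad_u J (S z) z)"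
  have g: "(g has_derivative (\<lambda>h. transpose ?H *v (?S' *v h))) (at zt)"
  proof -
    have "((\<lambda>z. (S z, z)) has_derivative (\<lambda>h. (?S' *v h, h))) (at zt)"
      by (rule derivative_eq_intros refl S')+
    from has_derivative_compose[OF this K]
    have "(g has_derivative (\<lambda>h. K (?S' *v h, h))) (at zt)" by (simp add: g_def)
    moreover have "K (?S' *v h, h) = transpose ?H *v (?S' *v h)" for h
      using linear_add[OF linK, of "(?S' *v h, 0)" "(0, h)"] K1 K2 by simp
    ultimately show ?thesis by simp
  qed
  let ?D = "\<lambda>z. discrepancy_matrix Mz z :: real^('m + 'm \<times> 'n)^'m"
  have grad_f: "gradient (f z) 0 = transpose (?D z) *v g z" for z
  proof (rule gradient_eqI)
    have lin: "((\<lambda>\<theta>. S z + ?D z *v \<theta>) has_derivative (\<lambda>h. ?D z *v h)) (at 0)"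
      by (rule derivative_eq_intros refl bounded_linear_imp_has_derivative matrix_vector_mul_bounded_linear | simp)+
    have "GDERIV (\<lambda>u. J u z) (S z + ?D z *v 0) :> g z"
      using G[of z "S z"] by (simp add: g_def grad_q)
    hence "((\<lambda>u. J u z) has_derivative (\<lambda>h. h \<bullet> g z)) (at (S z + ?D z *v 0))" by (simp add: gderiv_def)
    from has_derivative_compose[OF lin this]
    show "GDERIV (f z) 0 :> transpose (?D z) *v g z"
      by (simp add: gderiv_def f_def reduced_objective_def[abs_def] discrepancy_def dot_lmul_matrix[symmetric] inner_commute)
  qed
  have comp: "(transpose (?D z) *v x) = stack x (\<chi> p. (z v* Mz) $ snd p * x $ fst p)" for z x
    by (auto simp: vec_eq_iff stack_def discrepancy_matrix_def hblock_def kron_mat_row_def kron_def rowvector_def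
       transpose_def matrix_vector_mult_def mat_def if_distrib[where f="\<lambda>x. x * _"] split: sum.split cong: if_cong)
  have vm: "((\<lambda>z. (z v* Mz) $ l) has_derivative (\<lambda>h. (h v* Mz) $ l)) (at zt)" for l
    by (rule linear_imp_has_derivative, rule linearI)
       (auto simp: vector_matrix_mult_def sum.distrib algebra_simps sum_distrib_left)
  have gi: "((\<lambda>z. g z $ j) has_derivative (\<lambda>h. (transpose ?H *v (?S' *v h)) $ j)) (at zt)" for j
    using bounded_linear.has_derivative[OF bounded_linear_vec_nth g] .
  let ?L = "\<lambda>h. stack (transpose ?H *v (?S' *v h)) 
     (\<chi> p. (zt v* Mz) $ snd p * (transpose ?H *v (?S' *v h)) $ fst p + (h v* Mz) $ snd p * g zt $ fst p) :: real^('m + 'm \<times> 'n)"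
  have "((\<lambda>z. gradient (f z) 0) has_derivative ?L) (at zt)"
  proof (subst has_derivative_componentwise_within, rule ballI)
    fix b :: "real^('m + 'm \<times> 'n)" assume "b \<in> Basis"
    then obtain c where b: "b = axis c 1" by (auto simp: Basis_vec_def)
    show "((\<lambda>z. gradient (f z) 0 \<bullet> b) has_derivative (\<lambda>h. ?L h \<bullet> b)) (at zt)"
    proof (cases c)
      case (Inl a)
      show ?thesis unfolding b Inl grad_f comp using gi by (simp add: inner_axis stack_def)
    next
      case (Inr p)
      show ?thesis unfolding b Inr grad_f comp
        using has_derivative_mult[OF vm[of "snd p"] gi[of "fst p"]]
        by (simp add: inner_axis stack_def)
    qed
  qed
  hence "jacobian (\<lambda>z. gradient (f z) 0) (at zt) = matrix ?L" by (rule matrix_of_has_derivative)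
  hence "mixed_hessian f zt 0 = transpose (matrix ?L)" by (simp add: mixed_hessian_def)
  moreover have "matrix ?L = transpose (transpose ?S' ** ?H ** ?D zt + hblock 0 (kron_row_mat (g zt) Mz))" (is "_ = ?R")
  proof -
    have *: "?R *v h = ?L h" for h
    proof -
      have 1: "transpose (transpose ?S' ** ?H ** ?D zt) *v h = transpose (?D zt) *v (transpose ?H *v (?S' *v h))"
        by (simp add: matrix_transpose_mul matrix_vector_mul_assoc matrix_mul_assoc)
      have 2: "transpose (hblock 0 (kron_row_mat (g zt) Mz)) *v h = stack 0 (\<chi> p. (h v* Mz) $ snd p * g zt $ fst p)"
        by (auto simp: vec_eq_iff stack_def hblock_def kron_row_mat_def kron_def rowvector_def
          transpose_def matrix_vector_mult_def vector_matrix_mult_def sum_distrib_left mult_ac split: sum.split intro!: sum.cong)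
      have 3: "transpose (X + Y) *v h = transpose X *v h + transpose Y *v h" for X Y :: "real^('m + 'm \<times> 'n)^'n"
        by (simp add: vec_eq_iff transpose_def matrix_vector_mult_def algebra_simps sum.distrib)
      show ?thesis unfolding 3 1 2 comp by (auto simp: vec_eq_iff stack_def split: sum.split)
    qed
    have "matrix ?L = matrix ((*v) ?R)" using * by presburger
    thus ?thesis by simp
  qed
  ultimately show ?thesis by (simp add: f_def g_def)
qed

end

theory Submission
  imports Defs
begin

text \<open>Write \<open>g\<close> for the gradient of \<open>J\<close> in \<open>u\<close>, \<open>c\<close> for the square root of
  \<open>g \<bullet> W\<^sub>u\<^sup>-\<^sup>1 g\<close> and \<open>R\<close> for the square root of \<open>W\<^sub>z\<^sup>-\<^sup>1\<close>.

  The coefficients \<open>s\<^sub>k\<close> and \<open>y\<^sub>k\<close> are chosen so that every summand of the parameter sample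
  produces no discrepancy at the point \<open>zt\<close>. Hence the curvature term of \<open>B\<close> maps the
  sample to zero, and the gradient term leaves the sum of the vectors \<open>(g \<bullet> u\<^sub>k) R zb\<^sub>k\<close>
  (\<open>mixed_hessian_mult_theta_sample\<close>). On the other side, conjugating by \<open>R\<close> turns the oblique
  projection in \<open>\<Gamma>\<close> into the orthogonal projection onto the complement of the range of \<open>R Z\<^sub>c\<close>.
  Because the differences \<open>z\<^sub>l - z\<^sub>1\<close> are linearly independent, that complement has exactly
  as many dimensions as there are vectors \<open>zb\<^sub>k\<close>, so these are an orthonormal basis of it
  and \<open>\<Gamma> \<nu>\<close> is the sum of the vectors \<open>c (R\<^sup>-\<^sup>1 zb\<^sub>k \<bullet> \<nu>) R zb\<^sub>k\<close> (\<open>Gamma_matrix_mult\<close>).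

  Both random vectors are therefore images, under one and the same linear map, of coefficient
  families, and both families consist of \<open>c\<close> times independent standard normal variables. For
  \<open>\<nu>\<close> this holds because the vectors \<open>R\<^sup>-\<^sup>1 zb\<^sub>k\<close> are orthonormal for the inner product given by
  the covariance matrix \<open>W\<^sub>z\<^sup>-\<^sup>1\<close>, for \<open>u\<^sub>k\<close> because \<open>g / c\<close> is a unit vector for the one given by
  \<open>W\<^sub>u\<^sup>-\<^sup>1\<close>, the independence over \<open>k\<close> being assumed. If \<open>g = 0\<close>, both random vectors vanish.

  The probabilistic fact used twice is \<open>distr_gaussian_conjugate_coordinates\<close>: the coordinates
  of a vector with law \<open>\<N>(0, C)\<close> along a \<open>C\<close>-orthonormal family are independent standard
  normals. The family is extended to a \<open>C\<close>-orthonormal basis, whose members are the rows of a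
  whitening matrix \<open>A\<close>, that is \<open>A C A\<^sup>T = I\<close>. The density of \<open>\<N>(0, C)\<close> at \<open>x\<close> is then a constant
  times the standard density at \<open>A x\<close>. A linear bijection multiplies Lebesgue measure by a
  constant, and since all measures involved are probability measures the two constants cancel,
  so that neither determinant has to be computed.\<close>

section \<open>Symmetric positive definite matrices\<close>

lemma matrix_inv_eqI:
  fixes A B :: "real^'n^'n"
  assumes "A ** B = mat 1"
  shows "matrix_inv A = B"
proof -
  have BA: "B ** A = mat 1" using assms matrix_left_right_inverse by blast
  have "A ** matrix_inv A = mat 1 \<and> matrix_inv A ** A = mat 1"
    unfolding matrix_inv_def by (rule someI[of _ B]) (use assms BA in auto)
  thus ?thesis by (metis BA matrix_mul_assoc matrix_mul_lid matrix_mul_rid)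
qed

lemma pos_def_matrix_inv:
  fixes A :: "real^'n^'n"
  assumes "pos_def A"
  shows "A ** matrix_inv A = mat 1" "matrix_inv A ** A = mat 1"
proof -
  have "\<forall>x. A *v x = 0 \<longrightarrow> x = 0"
    using assms unfolding pos_def_def by (metis inner_zero_right less_irrefl)
  then obtain B where "B ** A = mat 1" using matrix_left_invertible_ker[of A] by blast
  hence "A ** B = mat 1" using matrix_left_right_inverse by blast
  with matrix_inv_eqI[OF this] \<open>B ** A = mat 1\<close>
  show "A ** matrix_inv A = mat 1" "matrix_inv A ** A = mat 1" by auto
qed

lemma inner_matrix_vector_mult_left:
  fixes A :: "real^'n^'m"
  shows "(A *v x) \<bullet> y = x \<bullet> (transpose A *v y)"
  using dot_lmul_matrix[of x "transpose A" y] transpose_matrix_vector[of "transpose A" x] by simp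

lemma spd_matrix_inv:
  fixes A :: "real^'n^'n"
  assumes "spd A"
  shows "spd (matrix_inv A)"
proof -
  have pd: "pos_def A" and sym: "transpose A = A" using assms by (auto simp: spd_def)
  note inv = pos_def_matrix_inv[OF pd]
  have "transpose (matrix_inv A) = matrix_inv A"
  proof (rule matrix_inv_eqI[symmetric])
    show "A ** transpose (matrix_inv A) = mat 1"
      by (metis inv(2) matrix_transpose_mul sym transpose_mat)
  qed
  moreover have "x \<bullet> (matrix_inv A *v x) > 0" if "x \<noteq> 0" for x
  proof -
    define y where "y = matrix_inv A *v x"
    have x: "x = A *v y" by (simp add: y_def matrix_vector_mul_assoc inv)
    hence "y \<noteq> 0" using that by auto
    hence "y \<bullet> (A *v y) > 0" using pd by (auto simp: pos_def_def)
    thus ?thesis unfolding y_def[symmetric] by (subst x) (simp add: inner_commute)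
  qed
  ultimately show ?thesis by (auto simp: spd_def pos_def_def)
qed

section \<open>Vectors orthonormal with respect to a covariance matrix\<close>

definition conjugate_orthonormal :: "real^'n^'n \<Rightarrow> (real^'n) set \<Rightarrow> bool" where
  "conjugate_orthonormal C E \<longleftrightarrow>
     finite E \<and> (\<forall>x\<in>E. \<forall>y\<in>E. x \<bullet> (C *v y) = (if x = y then 1 else 0))"

text \<open>Pairing a vanishing linear combination with \<open>C x\<close> isolates the coefficient of \<open>x\<close>, so the
  family is linearly independent.\<close>

lemma conjugate_orthonormal_card_le:
  fixes C :: "real^'n^'n"
  assumes "conjugate_orthonormal C E"
  shows "card E \<le> CARD('n)"
proof -
  have fin: "finite E" and E: "\<And>x y. x \<in> E \<Longrightarrow> y \<in> E \<Longrightarrow> x \<bullet> (C *v y) = (if x = y then 1 else 0)"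
    using assms by (auto simp: conjugate_orthonormal_def)
  have "u x = 0" if u: "(\<Sum>v\<in>E. u v *\<^sub>R v) = 0" and x: "x \<in> E" for u x
  proof -
    have "0 = (\<Sum>v\<in>E. u v *\<^sub>R v) \<bullet> (C *v x)" using u by simp
    also have "\<dots> = (\<Sum>v\<in>E. u v * (v \<bullet> (C *v x)))" by (simp add: inner_sum_left)
    also have "\<dots> = (\<Sum>v\<in>E. if v = x then u v else 0)"
      by (rule sum.cong) (auto simp: E x)
    also have "\<dots> = u x" using fin x by simp
    finally show ?thesis by simp
  qed
  hence "independent E" using independent_if_scalars_zero[OF fin] by blast
  hence "card E \<le> DIM(real^'n)" using independent_card_le by blast
  thus ?thesis by simp
qed

text \<open>The image of \<open>E\<close> under \<open>C\<close> is too small to span the space, so some nonzero vector is orthogonal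
  to it; scaled to length one in the \<open>C\<close>-norm, it extends \<open>E\<close>.\<close>

lemma conjugate_orthonormal_insert:
  fixes C :: "real^'n^'n"
  assumes C: "spd C" and E: "conjugate_orthonormal C E" and card: "card E < CARD('n)"
  obtains w where "w \<notin> E" "conjugate_orthonormal C (insert w E)"
proof -
  have fin: "finite E" using E by (simp add: conjugate_orthonormal_def)
  have "card ((\<lambda>x. C *v x) ` E) < DIM(real^'n)"
    using card card_image_le[OF fin, of "\<lambda>x. C *v x"] by simp
  hence "dim ((\<lambda>x. C *v x) ` E) < DIM(real^'n)"
    using dim_le_card'[of "(\<lambda>x. C *v x) ` E"] fin by simp
  then obtain v where v: "v \<noteq> 0" "\<And>y. y \<in> span ((\<lambda>x. C *v x) ` E) \<Longrightarrow> orthogonal v y"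
    using orthogonal_to_subspace_exists by blast
  have vpos: "v \<bullet> (C *v v) > 0" using C v by (auto simp: spd_def pos_def_def)
  define w where "w = (1 / sqrt (v \<bullet> (C *v v))) *\<^sub>R v"
  have ww: "w \<bullet> (C *v w) = 1"
    using vpos by (simp add: w_def matrix_vector_mult_scaleR)
  have wE: "w \<bullet> (C *v x) = 0" if "x \<in> E" for x
    using v(2)[OF span_base, of "C *v x"] that by (simp add: w_def orthogonal_def)
  \<comment> \<open>symmetry of \<open>C\<close> transfers the orthogonality to the other side\<close>
  have Ew: "x \<bullet> (C *v w) = 0" if "x \<in> E" for x
    using wE[OF that] C inner_matrix_vector_mult_left[of C w x] by (simp add: spd_def inner_commute)
  have "w \<notin> E" using ww wE by force
  moreover have "conjugate_orthonormal C (insert w E)"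
    using E ww wE Ew \<open>w \<notin> E\<close> unfolding conjugate_orthonormal_def by auto
  ultimately show ?thesis by (rule that)
qed

lemma conjugate_orthonormal_extension:
  fixes C :: "real^'n^'n"
  assumes C: "spd C" and E: "conjugate_orthonormal C E"
  obtains F where "E \<subseteq> F" "card F = CARD('n)" "conjugate_orthonormal C F"
proof -
  let ?P = "\<lambda>F. E \<subseteq> F \<and> conjugate_orthonormal C F"
  have PE: "?P E" using E by simp
  have bound: "\<forall>F. ?P F \<longrightarrow> card F \<le> CARD('n)" using conjugate_orthonormal_card_le by blast
  hence "\<forall>F. ?P F \<longrightarrow> card F < Suc (CARD('n))" by (simp add: less_Suc_eq_le)
  with PE obtain F where F: "?P F" and max: "\<And>G. ?P G \<Longrightarrow> card G \<le> card F"
    using ex_has_greatest_nat[of ?P E card "Suc (CARD('n))"] by blast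
  have "\<not> card F < CARD('n)"
  proof
    assume "card F < CARD('n)"
    then obtain w where w: "w \<notin> F" "conjugate_orthonormal C (insert w F)"
      using conjugate_orthonormal_insert C F by blast
    have "finite F" using F by (simp add: conjugate_orthonormal_def)
    moreover have "card (insert w F) \<le> card F" by (rule max) (use F w in auto)
    ultimately show False using w(1) by simp
  qed
  with conjugate_orthonormal_card_le F have "card F = CARD('n)" by (metis le_neq_implies_less)
  with F that show ?thesis by blast
qed

text \<open>The rows of \<open>A\<close> are the members of a \<open>C\<close>-orthonormal basis that contains the given family, and
  \<open>\<tau>\<close> records in which row each given vector sits.\<close>

lemma whitening_matrix_exists:
  fixes C :: "real^'n^'n" and a :: "'i \<Rightarrow> real^'n"
  assumes C: "spd C" and fin: "finite I"
    and a: "\<And>i j. i \<in> I \<Longrightarrow> j \<in> I \<Longrightarrow> a i \<bullet> (C *v a j) = (if i = j then 1 else 0)"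
  obtains A :: "real^'n^'n" and \<tau> :: "'i \<Rightarrow> 'n"
  where "A ** C ** transpose A = mat 1" "inj_on \<tau> I" "\<And>i. i \<in> I \<Longrightarrow> A $ \<tau> i = a i"
proof -
  have inj: "inj_on a I" by (rule inj_onI) (metis a zero_neq_one)
  have "conjugate_orthonormal C (a ` I)"
    using fin a inj by (auto simp: conjugate_orthonormal_def inj_on_def)
  then obtain F where F: "a ` I \<subseteq> F" "card F = CARD('n)" and CF: "conjugate_orthonormal C F"
    by (rule conjugate_orthonormal_extension[OF C])
  have "finite F" using CF by (simp add: conjugate_orthonormal_def)
  obtain h where h: "bij_betw h F (UNIV :: 'n set)"
    using F(2) \<open>finite F\<close> by (metis bij_betw_iff_card finite_class.finite_UNIV)
  define A :: "real^'n^'n" where "A = (\<chi> j. inv_into F h j)"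
  have "A ** C ** transpose A = mat 1"
  proof -
    have "(A ** C ** transpose A) $ i $ j = A $ i \<bullet> (C *v (A $ j))" for i j
    proof -
      have "(A ** C ** transpose A) $ i $ j = ((A ** C) $ i) \<bullet> A $ j"
        by (simp add: matrix_matrix_mult_def inner_vec_def transpose_def)
      also have "(A ** C) $ i = (A $ i) v* C"
        by (simp add: vec_eq_iff matrix_matrix_mult_def vector_matrix_mult_def mult.commute)
      finally show ?thesis by (simp add: dot_lmul_matrix)
    qed
    moreover have "A $ i \<bullet> (C *v (A $ j)) = (if i = j then 1 else 0)" for i j
    proof -
      have "A $ i \<in> F" "A $ j \<in> F" "A $ i = A $ j \<longleftrightarrow> i = j"
        using h by (auto simp: A_def bij_betw_def intro!: inv_into_into dest: inv_into_injective)
      thus ?thesis using CF by (simp add: conjugate_orthonormal_def)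
    qed
    ultimately show ?thesis by (simp add: vec_eq_iff mat_def)
  qed
  moreover have "inj_on (h \<circ> a) I"
    using inj h F(1) by (intro comp_inj_on) (auto simp: bij_betw_def inj_on_subset)
  moreover have "A $ (h \<circ> a) i = a i" if "i \<in> I" for i
    using that h F(1) by (auto simp: A_def bij_betw_def inv_into_f_f)
  ultimately show ?thesis using that by blast
qed

section \<open>Projections and orthonormal expansions\<close>

text \<open>The orthogonal complement of \<open>T\<close> has dimension \<open>card I\<close>, so the orthonormal family \<open>b\<close> inside it
  spans it. The vector \<open>d\<close> lies in that complement and is orthogonal to its spanning set, hence
  to itself.\<close>

lemma zero_if_orthogonal_to_complementary_subspaces:
  fixes T :: "(real^'n) set" and b :: "'i \<Rightarrow> real^'n"
  assumes T: "subspace T" and I: "finite I" "card I + dim T = CARD('n)"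
    and b: "\<And>i j. i \<in> I \<Longrightarrow> j \<in> I \<Longrightarrow> b i \<bullet> b j = (if i = j then 1 else 0)"
    and bT: "\<And>i t. i \<in> I \<Longrightarrow> t \<in> T \<Longrightarrow> t \<bullet> b i = 0"
    and d: "\<And>i. i \<in> I \<Longrightarrow> b i \<bullet> d = 0" "\<And>t. t \<in> T \<Longrightarrow> t \<bullet> d = 0"
  shows "d = 0"
proof -
  define W where "W = {y. \<forall>x\<in>T. orthogonal x y}"
  have "dim {y \<in> UNIV. \<forall>x\<in>T. orthogonal x y} + dim T = dim (UNIV :: (real^'n) set)"
    by (rule dim_subspace_orthogonal_to_vectors) (use T in auto)
  hence "dim W = card I"
    using I by (simp add: W_def)
  have inj: "inj_on b I" by (rule inj_onI) (metis b zero_neq_one)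
  have orth: "pairwise orthogonal (b ` I)"
    using b by (auto simp: pairwise_def orthogonal_def)
  have "0 \<notin> b ` I" using b by force
  hence ind: "independent (b ` I)" using pairwise_orthogonal_independent orth by blast
  have "b ` I \<subseteq> W" using bT by (auto simp: W_def orthogonal_def)
  hence "W \<subseteq> span (b ` I)"
    using card_ge_dim_independent[OF _ ind] \<open>dim W = card I\<close> card_image[OF inj] by simp
  hence "d \<in> span (b ` I)" using d(2) by (auto simp: W_def orthogonal_def)
  hence "orthogonal d d"
    by (rule orthogonal_to_span) (use d(1) in \<open>auto simp: orthogonal_def inner_commute\<close>)
  thus ?thesis by (simp add: orthogonal_def)
qed

lemma inner_orthonormal_sum:
  fixes b :: "'i \<Rightarrow> 'a::real_inner"
  assumes I: "finite I"
    and b: "\<And>i j. i \<in> I \<Longrightarrow> j \<in> I \<Longrightarrow> b i \<bullet> b j = (if i = j then 1 else 0)"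
    and i: "i \<in> I"
  shows "b i \<bullet> (\<Sum>j\<in>I. c j *\<^sub>R b j) = c i"
proof -
  have "b i \<bullet> (\<Sum>j\<in>I. c j *\<^sub>R b j) = (\<Sum>j\<in>I. if i = j then c j else 0)"
    unfolding inner_sum_right by (rule sum.cong) (auto simp: b i)
  thus ?thesis using I i by simp
qed

text \<open>The subtracted term is the orthogonal projection of \<open>y\<close> onto the range of \<open>V\<close>. The difference of
  the two sides is orthogonal both to that range and to every \<open>b i\<close>, and these together fill the
  space by the dimension count.\<close>

lemma orthonormal_complement_expansion:
  fixes V :: "real^'k^'n" and b :: "'i \<Rightarrow> real^'n"
  assumes ker: "\<And>x. V *v x = 0 \<Longrightarrow> x = 0"
    and I: "finite I" "card I + CARD('k) = CARD('n)"
    and b: "\<And>i j. i \<in> I \<Longrightarrow> j \<in> I \<Longrightarrow> b i \<bullet> b j = (if i = j then 1 else 0)"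
    and Vb: "\<And>i. i \<in> I \<Longrightarrow> transpose V *v b i = 0"
  shows "y - V *v (matrix_inv (transpose V ** V) *v (transpose V *v y)) = (\<Sum>i\<in>I. (b i \<bullet> y) *\<^sub>R b i)"
proof -
  let ?G = "transpose V ** V"
  have "pos_def ?G"
  proof -
    have "x \<bullet> (?G *v x) = (V *v x) \<bullet> (V *v x)" for x
      by (simp add: inner_matrix_vector_mult_left matrix_vector_mul_assoc)
    thus ?thesis using ker by (auto simp: pos_def_def)
  qed
  note G = pos_def_matrix_inv[OF this]
  define Q where "Q = V *v (matrix_inv ?G *v (transpose V *v y))"
  define d where "d = y - Q - (\<Sum>i\<in>I. (b i \<bullet> y) *\<^sub>R b i)"
  have bV: "(V *v x) \<bullet> b i = 0" if "i \<in> I" for i x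
    by (simp only: inner_matrix_vector_mult_left Vb[OF that] inner_zero_right)
  have "d = 0"
  proof (rule zero_if_orthogonal_to_complementary_subspaces[of "range ((*v) V)" I b])
    have "inj ((*v) V)"
      using ker by (simp add: linear_injective_0 matrix_vector_mul_linear)
    hence "dim (range ((*v) V)) = dim (UNIV :: (real^'k) set)"
      by (intro dim_image_eq) (auto simp: matrix_vector_mul_linear)
    thus "card I + dim (range ((*v) V)) = CARD('n)" using I by simp
    show "subspace (range ((*v) V))"
      by (simp add: linear_subspace_image matrix_vector_mul_linear)
    show "t \<bullet> b i = 0" if "i \<in> I" "t \<in> range ((*v) V)" for i t
      using that bV by auto
    show "b i \<bullet> d = 0" if i: "i \<in> I" for i
    proof -
      have "b i \<bullet> Q = 0" using bV[OF i] by (simp add: Q_def inner_commute)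
      thus ?thesis by (simp add: d_def inner_diff_right inner_orthonormal_sum[OF I(1) b i])
    qed
    show "t \<bullet> d = 0" if t: "t \<in> range ((*v) V)" for t
    proof -
      obtain x where x: "t = V *v x" using t by auto
      have "transpose V *v Q = ?G *v (matrix_inv ?G *v (transpose V *v y))"
        by (simp add: Q_def matrix_vector_mul_assoc matrix_mul_assoc)
      also have "\<dots> = (?G ** matrix_inv ?G) *v (transpose V *v y)"
        by (simp add: matrix_vector_mul_assoc)
      also have "\<dots> = transpose V *v y" by (simp add: G)
      finally have "t \<bullet> Q = t \<bullet> y" by (simp add: x inner_matrix_vector_mult_left)
      moreover have "t \<bullet> (\<Sum>j\<in>I. (b j \<bullet> y) *\<^sub>R b j) = 0"
        unfolding inner_sum_right by (rule sum.neutral) (simp add: x bV)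
      ultimately show ?thesis by (simp add: d_def inner_diff_right)
    qed
  qed (use I b in auto)
  thus ?thesis by (simp add: d_def Q_def)
qed

lemma orthonormal_basis_expansion:
  fixes b :: "'i \<Rightarrow> real^'n"
  assumes I: "finite I" "card I = CARD('n)"
    and b: "\<And>i j. i \<in> I \<Longrightarrow> j \<in> I \<Longrightarrow> b i \<bullet> b j = (if i = j then 1 else 0)"
  shows "y = (\<Sum>i\<in>I. (b i \<bullet> y) *\<^sub>R b i)"
proof -
  have "y - (\<Sum>i\<in>I. (b i \<bullet> y) *\<^sub>R b i) = 0"
  proof (rule zero_if_orthogonal_to_complementary_subspaces[of "{0}" I b])
    show "b i \<bullet> (y - (\<Sum>i\<in>I. (b i \<bullet> y) *\<^sub>R b i)) = 0" if i: "i \<in> I" for i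
      by (simp add: inner_diff_right inner_orthonormal_sum[OF I(1) b i])
  qed (use I b in auto)
  thus ?thesis by simp
qed

lemma independent_family_coefficients_zero:
  fixes f :: "'i \<Rightarrow> 'a::real_vector"
  assumes I: "finite I" "inj_on f I" "independent (f ` I)"
    and sum: "(\<Sum>i\<in>I. c i *\<^sub>R f i) = 0" and i: "i \<in> I"
  shows "c i = 0"
proof -
  let ?u = "c \<circ> inv_into I f"
  have "(\<Sum>v\<in>f ` I. ?u v *\<^sub>R v) = (\<Sum>i\<in>I. c i *\<^sub>R f i)"
    by (subst sum.reindex[OF I(2)]) (auto intro!: sum.cong simp: inv_into_f_f[OF I(2)])
  hence "?u (f i) = 0"
    using independentD[OF I(3), of "f ` I" ?u "f i"] I i sum by simp
  thus ?thesis by (simp add: inv_into_f_f[OF I(2) i])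
qed

text \<open>A vanishing combination of the differences is a vanishing combination of the \<open>z\<^sub>l\<close> in which \<open>z\<^sub>1\<close>
  carries minus the sum of the coefficients.\<close>

lemma difference_matrix_injective:
  fixes z :: "nat \<Rightarrow> real^'n" and col :: "'k::finite \<Rightarrow> nat" and Zc :: "real^'k^'n"
  assumes z: "inj_on z {1..N}" "independent (z ` {1..N})"
    and col: "bij_betw col UNIV {2..N}"
    and Zc: "Zc = (\<chi> i k. (z (col k) - z 1) $ i)"
    and x: "Zc *v x = 0"
  shows "x = 0"
proof -
  define c where "c l = (if l = 1 then - (\<Sum>k\<in>UNIV. x $ k) else x $ inv_into UNIV col l)" for l
  have inj: "inj col" and img: "col ` UNIV = {2..N}" using col by (auto simp: bij_betw_def)
  have N: "N \<ge> 2" using img by (metis atLeastatMost_empty_iff2 empty_not_UNIV image_is_empty)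
  have "Zc *v x = (\<Sum>k\<in>UNIV. x $ k *\<^sub>R (z (col k) - z 1))"
    by (simp add: vec_eq_iff Zc matrix_vector_mult_def mult.commute)
  also have "\<dots> = (\<Sum>k\<in>UNIV. x $ k *\<^sub>R z (col k)) - (\<Sum>k\<in>UNIV. x $ k) *\<^sub>R z 1"
    by (simp add: scaleR_diff_right sum_subtractf scaleR_sum_left)
  also have "(\<Sum>k\<in>UNIV. x $ k *\<^sub>R z (col k)) = (\<Sum>l\<in>{2..N}. c l *\<^sub>R z l)"
    unfolding img[symmetric]
  proof (subst sum.reindex[OF inj], rule sum.cong)
    fix k :: 'k
    have "col k \<in> {2..N}" using img by auto
    hence "col k \<noteq> 1" by auto
    thus "x $ k *\<^sub>R z (col k) = ((\<lambda>l. c l *\<^sub>R z l) \<circ> col) k"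
      by (simp add: c_def inv_into_f_f[OF inj])
  qed simp
  finally have "(\<Sum>l\<in>insert 1 {2..N}. c l *\<^sub>R z l) = 0"
    using x by (simp add: c_def)
  moreover have "insert 1 {2..N} = {1..N}" using N by auto
  ultimately have "(\<Sum>l\<in>{1..N}. c l *\<^sub>R z l) = 0" by (simp only:)
  hence c0: "c l = 0" if "l \<in> {1..N}" for l
    using independent_family_coefficients_zero[OF _ z _ that] by blast
  show "x = 0"
  proof (simp add: vec_eq_iff, rule allI)
    fix k
    have k: "col k \<in> {2..N}" using img by auto
    hence "c (col k) = 0" using c0 by auto
    thus "x $ k = 0" using k by (simp add: c_def inv_into_f_f[OF inj])
  qed
qed

text \<open>The matrix on the left is \<open>R (I - Q) R\<^sup>-\<^sup>1\<close>, where \<open>Q\<close> is the orthogonal projection onto the range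
  of \<open>R Z\<close>. Applied to \<open>x = R y\<close>, the expansion of \<open>(I - Q) y\<close> in the basis \<open>b\<close> of the complement gives
  the claim.\<close>

lemma oblique_projection_expansion:
  fixes R :: "real^'n^'n" and Z :: "real^'k^'n" and b :: "'i \<Rightarrow> real^'n"
  assumes R: "spd R" and ker: "\<And>x. Z *v x = 0 \<Longrightarrow> x = 0"
    and I: "finite I" "card I + CARD('k) = CARD('n)"
    and b: "\<And>i j. i \<in> I \<Longrightarrow> j \<in> I \<Longrightarrow> b i \<bullet> b j = (if i = j then 1 else 0)"
    and Zb: "\<And>i. i \<in> I \<Longrightarrow> transpose Z *v (R *v b i) = 0"
  shows "(mat 1 - (R ** R) ** Z ** matrix_inv (transpose Z ** (R ** R) ** Z) ** transpose Z) *v x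
       = (\<Sum>i\<in>I. ((matrix_inv R *v b i) \<bullet> x) *\<^sub>R (R *v b i))"
proof -
  have RT: "transpose R = R" and Rpd: "pos_def R" using R by (auto simp: spd_def)
  note Ri = pos_def_matrix_inv[OF Rpd]
  have RiT: "transpose (matrix_inv R) = matrix_inv R"
    using spd_matrix_inv[OF R] by (simp add: spd_def)
  let ?V = "R ** Z"
  have VT: "transpose ?V = transpose Z ** R" by (simp add: matrix_transpose_mul RT)
  define y where "y = matrix_inv R *v x"
  have x: "x = R *v y" by (simp add: y_def matrix_vector_mul_assoc Ri)
  have kerV: "u = 0" if "?V *v u = 0" for u
  proof -
    have "matrix_inv R *v (?V *v u) = Z *v u"
      by (simp add: matrix_vector_mul_assoc matrix_mul_assoc Ri)
    thus ?thesis using that ker by simp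
  qed
  have G: "transpose ?V ** ?V = transpose Z ** (R ** R) ** Z"
    by (simp add: VT matrix_mul_assoc)
  have "(mat 1 - (R ** R) ** Z ** matrix_inv (transpose Z ** (R ** R) ** Z) ** transpose Z) *v x
      = x - ((R ** R) ** Z ** matrix_inv (transpose Z ** (R ** R) ** Z) ** transpose Z) *v x"
    by (simp add: matrix_vector_mult_diff_rdistrib)
  also have "\<dots> = R *v (y - ?V *v (matrix_inv (transpose ?V ** ?V) *v (transpose ?V *v y)))"
    by (simp add: G VT x matrix_vector_mult_diff_distrib matrix_vector_mul_assoc matrix_mul_assoc)
  also have "\<dots> = R *v (\<Sum>i\<in>I. (b i \<bullet> y) *\<^sub>R b i)"
    by (subst orthonormal_complement_expansion[OF kerV I b])
       (use Zb in \<open>auto simp: VT matrix_vector_mul_assoc\<close>)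
  also have "\<dots> = (\<Sum>i\<in>I. (b i \<bullet> y) *\<^sub>R (R *v b i))"
    by (simp add: linear_sum[OF matrix_vector_mul_linear] matrix_vector_mult_scaleR)
  also have "\<dots> = (\<Sum>i\<in>I. ((matrix_inv R *v b i) \<bullet> x) *\<^sub>R (R *v b i))"
    by (simp add: y_def inner_matrix_vector_mult_left RiT)
  finally show ?thesis .
qed

section \<open>Linear maps and coordinates for Lebesgue measure\<close>

lemma borel_measurable_matrix_vector_mult [measurable]:
  fixes A :: "real^'n^'m"
  shows "(*v) A \<in> borel_measurable borel"
  by (simp add: borel_measurable_continuous_onI matrix_vector_mul_linear linear_continuous_on)

lemma borel_measurable_vec_component [measurable]:
  "(\<lambda>y :: real^'n. y $ i) \<in> borel_measurable borel"
  by (simp add: borel_measurable_continuous_onI continuous_intros)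

lemma measurable_vec_components [measurable]:
  "(\<lambda>(y :: real^'n) i. y $ i) \<in> borel \<rightarrow>\<^sub>M (\<Pi>\<^sub>M i\<in>UNIV. borel)"
  by (rule measurable_PiM_single') auto

lemma measurable_vec_of_components [measurable]:
  "(\<lambda>f. (\<chi> i. f i) :: real^'n) \<in> borel_measurable (\<Pi>\<^sub>M i\<in>UNIV. lborel)"
  by (subst borel_measurable_euclidean_space) (auto simp: Basis_vec_def inner_axis)

lemma nn_integral_lborel_translate:
  fixes f :: "'a::euclidean_space \<Rightarrow> ennreal"
  assumes [measurable]: "f \<in> borel_measurable borel"
  shows "(\<integral>\<^sup>+x. f (c + x) \<partial>lborel) = (\<integral>\<^sup>+x. f x \<partial>lborel)"
  by (subst (2) lborel_distr_plus[of c, symmetric]) (simp add: nn_integral_distr)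

lemma nn_integral_lborel_reflect:
  fixes f :: "'a::euclidean_space \<Rightarrow> ennreal"
  assumes [measurable]: "f \<in> borel_measurable borel"
  shows "(\<integral>\<^sup>+x. f (c - x) \<partial>lborel) = (\<integral>\<^sup>+x. f x \<partial>lborel)"
  by (subst (2) lborel_affine[of "-1" c])
     (simp_all add: nn_integral_density nn_integral_distr)

text \<open>Integration against the image of Lebesgue measure under \<open>A\<close> is proportional to Lebesgue
  integration. This is the uniqueness argument for Haar measure: in the double integral of
  \<open>f (A x + y) g y\<close>, translating \<open>x\<close> makes the first factor independent of \<open>y\<close>, while translating
  \<open>y\<close> moves the dependence on \<open>x\<close> into \<open>g\<close>, where it is removed by the reflection
  \<open>x \<mapsto> B y - x\<close>. The form as an identity of products of integrals avoids naming the factor,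
  which is the inverse of the absolute value of the determinant of \<open>A\<close>, and any division by
  integrals that may be infinite.\<close>

lemma nn_integral_linear_substitution_proportional:
  fixes A B :: "real^'n^'n" and f g :: "real^'n \<Rightarrow> ennreal"
  assumes AB: "A ** B = mat 1"
    and [measurable]: "f \<in> borel_measurable borel" "g \<in> borel_measurable borel"
  shows "(\<integral>\<^sup>+x. f (A *v x) \<partial>lborel) * (\<integral>\<^sup>+y. g y \<partial>lborel)
       = (\<integral>\<^sup>+y. f y \<partial>lborel) * (\<integral>\<^sup>+x. g (A *v x) \<partial>lborel)"
proof -
  have ABy: "A *v (B *v y) = y" for y
    by (simp add: matrix_vector_mul_assoc AB)
  have swap: "(\<integral>\<^sup>+y. \<integral>\<^sup>+x. h x y \<partial>lborel \<partial>lborel) = (\<integral>\<^sup>+x. \<integral>\<^sup>+y. h x y \<partial>lborel \<partial>lborel)"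
    if "(\<lambda>(x, y). h x y) \<in> borel_measurable (lborel \<Otimes>\<^sub>M lborel)" for h :: "real^'n \<Rightarrow> real^'n \<Rightarrow> ennreal"
    using lborel_pair.Fubini'[OF that] by simp
  have "(\<integral>\<^sup>+x. f (A *v x) \<partial>lborel) * (\<integral>\<^sup>+y. g y \<partial>lborel)
      = (\<integral>\<^sup>+y. (\<integral>\<^sup>+x. f (A *v x) \<partial>lborel) * g y \<partial>lborel)"
    by (simp add: nn_integral_cmult)
  also have "\<dots> = (\<integral>\<^sup>+y. (\<integral>\<^sup>+x. f (A *v x + y) * g y \<partial>lborel) \<partial>lborel)"
  proof (rule nn_integral_cong)
    fix y
    have "(\<integral>\<^sup>+x. f (A *v x) \<partial>lborel) = (\<integral>\<^sup>+x. f (A *v (B *v y + x)) \<partial>lborel)"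
      by (rule nn_integral_lborel_translate[symmetric]) measurable
    thus "(\<integral>\<^sup>+x. f (A *v x) \<partial>lborel) * g y = (\<integral>\<^sup>+x. f (A *v x + y) * g y \<partial>lborel)"
      by (simp add: nn_integral_multc matrix_vector_right_distrib ABy add.commute)
  qed
  also have "\<dots> = (\<integral>\<^sup>+x. (\<integral>\<^sup>+y. f (A *v x + y) * g y \<partial>lborel) \<partial>lborel)"
    by (rule swap) measurable
  also have "\<dots> = (\<integral>\<^sup>+x. (\<integral>\<^sup>+y. f y * g (y - A *v x) \<partial>lborel) \<partial>lborel)"
  proof (rule nn_integral_cong)
    fix x
    show "(\<integral>\<^sup>+y. f (A *v x + y) * g y \<partial>lborel) = (\<integral>\<^sup>+y. f y * g (y - A *v x) \<partial>lborel)"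
      using nn_integral_lborel_translate[of "\<lambda>y. f y * g (y - A *v x)" "A *v x"] by simp
  qed
  also have "\<dots> = (\<integral>\<^sup>+y. (\<integral>\<^sup>+x. f y * g (y - A *v x) \<partial>lborel) \<partial>lborel)"
    by (rule swap[symmetric]) measurable
  also have "\<dots> = (\<integral>\<^sup>+y. f y * (\<integral>\<^sup>+x. g (A *v x) \<partial>lborel) \<partial>lborel)"
  proof (rule nn_integral_cong)
    fix y
    have "(\<integral>\<^sup>+x. g (A *v x) \<partial>lborel) = (\<integral>\<^sup>+x. g (A *v (B *v y - x)) \<partial>lborel)"
      by (rule nn_integral_lborel_reflect[symmetric]) measurable
    thus "(\<integral>\<^sup>+x. f y * g (y - A *v x) \<partial>lborel) = f y * (\<integral>\<^sup>+x. g (A *v x) \<partial>lborel)"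
      by (simp add: nn_integral_cmult matrix_vector_mult_diff_distrib ABy)
  qed
  also have "\<dots> = (\<integral>\<^sup>+y. f y \<partial>lborel) * (\<integral>\<^sup>+x. g (A *v x) \<partial>lborel)"
    by (simp add: nn_integral_multc)
  finally show ?thesis .
qed

text \<open>The product structure of Lebesgue measure, indexed by the coordinates of \<open>real^'n\<close> instead of its
  basis vectors; both measures agree on boxes.\<close>

lemma distr_PiM_lborel_vec:
  "distr (\<Pi>\<^sub>M i\<in>UNIV. lborel) borel (\<lambda>f. \<chi> i. f i) = (lborel :: (real^'n) measure)"
proof (rule lborel_eqI[symmetric])
  interpret product_sigma_finite "\<lambda>_::'n. lborel :: real measure" ..
  fix l u :: "real^'n" assume lu: "\<And>b. b \<in> Basis \<Longrightarrow> l \<bullet> b \<le> u \<bullet> b"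
  have lu': "l $ i \<le> u $ i" for i using lu[of "axis i 1"] by (simp add: inner_axis axis_in_Basis_iff)
  have "(\<lambda>f. (\<chi> i. f i) :: real^'n) -` box l u \<inter> space (\<Pi>\<^sub>M i\<in>UNIV. lborel)
        = (\<Pi>\<^sub>E i\<in>UNIV. {l $ i<..<u $ i})"
    by (auto simp: space_PiM mem_box_cart PiE_iff)
  hence "emeasure (distr (\<Pi>\<^sub>M i\<in>UNIV. lborel) borel (\<lambda>f. \<chi> i. f i)) (box l u)
        = emeasure (\<Pi>\<^sub>M i\<in>UNIV. lborel) (\<Pi>\<^sub>E i\<in>UNIV. {l $ i<..<u $ i})"
    by (simp add: emeasure_distr)
  also have "\<dots> = (\<Prod>i\<in>UNIV. ennreal (u $ i - l $ i))"
    by (subst emeasure_PiM) (auto simp: lu')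
  also have "\<dots> = ennreal (\<Prod>i\<in>UNIV. u $ i - l $ i)"
    by (rule prod_ennreal) (simp add: lu')
  also have "(\<Prod>i\<in>UNIV. u $ i - l $ i) = (\<Prod>b\<in>Basis. (u - l) \<bullet> b)"
    by (simp add: Basis_vec_def prod.UNION_disjoint inner_axis axis_eq_axis)
  finally show "emeasure (distr (\<Pi>\<^sub>M i\<in>UNIV. lborel) borel (\<lambda>f. \<chi> i. f i)) (box l u)
      = (\<Prod>b\<in>Basis. (u - l) \<bullet> b)" .
qed simp

section \<open>Standard normal vectors\<close>

text \<open>Both measures agree on boxes, where the integral of a product of functions of single
  coordinates factors.\<close>

lemma density_PiM:
  fixes M :: "'i \<Rightarrow> 'a measure"
  assumes I: "finite I" and f[measurable]: "\<And>i. f i \<in> borel_measurable (M i)"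
    and M: "\<And>i. sigma_finite_measure (M i)" and D: "\<And>i. sigma_finite_measure (density (M i) (f i))"
  shows "density (PiM I M) (\<lambda>x. \<Prod>i\<in>I. f i (x i)) = (\<Pi>\<^sub>M i\<in>I. density (M i) (f i))"
proof -
  interpret M: product_sigma_finite M using M by (simp add: product_sigma_finite_def)
  interpret D: product_sigma_finite "\<lambda>i. density (M i) (f i)" using D by (simp add: product_sigma_finite_def)
  show ?thesis
  proof (rule D.PiM_eqI[OF I])
    show "sets (density (PiM I M) (\<lambda>x. \<Prod>i\<in>I. f i (x i))) = sets (\<Pi>\<^sub>M i\<in>I. density (M i) (f i))"
      by (simp cong: sets_PiM_cong)
    fix A assume "\<And>i. i \<in> I \<Longrightarrow> A i \<in> sets (density (M i) (f i))"
    hence A[measurable]: "\<And>i. i \<in> I \<Longrightarrow> A i \<in> sets (M i)" by simp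
    have "Pi\<^sub>E I A \<in> sets (PiM I M)" using I by (intro sets_PiM_I_finite) auto
    hence "emeasure (density (PiM I M) (\<lambda>x. \<Prod>i\<in>I. f i (x i))) (Pi\<^sub>E I A)
      = (\<integral>\<^sup>+x. (\<Prod>i\<in>I. f i (x i)) * indicator (Pi\<^sub>E I A) x \<partial>PiM I M)"
      by (subst emeasure_density) auto
    also have "\<dots> = (\<integral>\<^sup>+x. (\<Prod>i\<in>I. f i (x i) * indicator (A i) (x i)) \<partial>PiM I M)"
    proof (rule nn_integral_cong)
      fix x assume "x \<in> space (PiM I M)"
      hence "indicator (Pi\<^sub>E I A) x = (\<Prod>i\<in>I. indicator (A i) (x i) :: ennreal)"
        using I by (auto simp: space_PiM PiE_iff indicator_def prod_zero_iff)
      thus "(\<Prod>i\<in>I. f i (x i)) * indicator (Pi\<^sub>E I A) x = (\<Prod>i\<in>I. f i (x i) * indicator (A i) (x i))"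
        by (simp add: prod.distrib)
    qed
    also have "\<dots> = (\<Prod>i\<in>I. \<integral>\<^sup>+x. f i x * indicator (A i) x \<partial>M i)"
      using I by (intro M.product_nn_integral_prod) auto
    also have "\<dots> = (\<Prod>i\<in>I. emeasure (density (M i) (f i)) (A i))"
      by (intro prod.cong) (auto simp: emeasure_density)
    finally show "emeasure (density (PiM I M) (\<lambda>x. \<Prod>i\<in>I. f i (x i))) (Pi\<^sub>E I A)
      = (\<Prod>i\<in>I. emeasure (density (M i) (f i)) (A i))" .
  qed
qed

definition std_normal_measure :: "real measure" where
  "std_normal_measure = density lborel (\<lambda>x. ennreal (std_normal_density x))"

lemma prob_space_std_normal_measure: "prob_space std_normal_measure"
  unfolding std_normal_measure_def by (rule prob_space_normal_density) simp

lemma sets_std_normal_measure [measurable_cong, simp]: "sets std_normal_measure = sets borel"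
  by (simp add: std_normal_measure_def)

text \<open>The values are extended nonnegative reals, because the density is only ever used under a
  Lebesgue integral or as the density of a measure.\<close>

definition std_normal_vec_density :: "real^'n \<Rightarrow> ennreal" where
  "std_normal_vec_density y = (\<Prod>i\<in>UNIV. ennreal (std_normal_density (y $ i)))"

lemma borel_measurable_std_normal_vec_density [measurable]:
  "std_normal_vec_density \<in> borel_measurable borel"
  unfolding std_normal_vec_density_def by measurable

lemma distr_std_normal_vec_components:
  "distr (density lborel (std_normal_vec_density :: real^'n \<Rightarrow> ennreal))
     (\<Pi>\<^sub>M i\<in>UNIV. borel) (\<lambda>y i. y $ i) = (\<Pi>\<^sub>M i\<in>UNIV. std_normal_measure)"
proof -
  let ?g = "std_normal_vec_density :: real^'n \<Rightarrow> ennreal"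
  have "distr (density lborel ?g) (\<Pi>\<^sub>M i\<in>UNIV. borel) (\<lambda>y i. y $ i)
      = distr (density (distr (\<Pi>\<^sub>M i\<in>UNIV. lborel) borel (\<lambda>f. \<chi> i. f i)) ?g) (\<Pi>\<^sub>M i\<in>UNIV. lborel) (\<lambda>y i. y $ i)"
    unfolding distr_PiM_lborel_vec by (rule distr_cong) (auto cong: sets_PiM_cong)
  also have "\<dots> = density (\<Pi>\<^sub>M i\<in>UNIV. lborel) (?g \<circ> (\<lambda>f. \<chi> i. f i))"
  proof (rule distr_density_distr)
    show "(\<lambda>(y::real^'n) i. y $ i) \<in> borel \<rightarrow>\<^sub>M (\<Pi>\<^sub>M i\<in>UNIV. lborel)"
      using measurable_vec_components by (simp cong: measurable_cong_sets sets_PiM_cong)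
  qed auto
  also have "\<dots> = density (\<Pi>\<^sub>M i\<in>UNIV. lborel) (\<lambda>x. \<Prod>i\<in>UNIV. ennreal (std_normal_density (x i)))"
    by (simp add: o_def std_normal_vec_density_def)
  also have "\<dots> = (\<Pi>\<^sub>M i\<in>UNIV. std_normal_measure)"
    unfolding std_normal_measure_def
    by (rule density_PiM)
       (use prob_space_std_normal_measure lborel.sigma_finite_measure_axioms in
        \<open>auto simp: std_normal_measure_def prob_space_imp_sigma_finite\<close>)
  finally show ?thesis .
qed

section \<open>Whitening of Gaussian vectors\<close>

text \<open>From \<open>A C A\<^sup>T = I\<close> the inverse covariance is \<open>A\<^sup>T A\<close>, so the exponent is half the negative squared
  length of \<open>A x\<close>. The constant \<open>k\<close> stays unspecified since it is recovered from the total mass.\<close>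

lemma gaussian_density_whitening:
  fixes A C :: "real^'n^'n"
  assumes A: "A ** C ** transpose A = mat 1"
  obtains k where "\<And>x. ennreal (gaussian_density C x) = k * std_normal_vec_density (A *v x)"
proof -
  have "transpose A ** (A ** C) = mat 1" using A matrix_left_right_inverse by blast
  hence "C ** (transpose A ** A) = mat 1"
    by (metis matrix_left_right_inverse matrix_mul_assoc)
  hence inv: "matrix_inv C = transpose A ** A" by (rule matrix_inv_eqI)
  \<comment> \<open>the ratio of the normalizations of the two densities\<close>
  define K where "K = sqrt (2 * pi) ^ CARD('n) / sqrt ((2 * pi) ^ CARD('n) * det C)"
  have "ennreal (gaussian_density C x) = ennreal K * std_normal_vec_density (A *v x)" for x
  proof -
    let ?y = "A *v x"
    have "x \<bullet> (matrix_inv C *v x) = ?y \<bullet> ?y"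
      by (simp add: inv inner_matrix_vector_mult_left matrix_vector_mul_assoc)
    also have "\<dots> = (\<Sum>i\<in>UNIV. (?y $ i)\<^sup>2)" by (simp add: inner_vec_def power2_eq_square)
    finally have "exp (- (x \<bullet> (matrix_inv C *v x)) / 2) = (\<Prod>i\<in>UNIV. exp (- (?y $ i)\<^sup>2 / 2))"
      by (simp add: exp_sum[symmetric] sum_negf sum_divide_distrib)
    also have "\<dots> = (\<Prod>i\<in>UNIV. sqrt (2 * pi) * std_normal_density (?y $ i))"
      by (simp add: std_normal_density_def)
    also have "\<dots> = sqrt (2 * pi) ^ CARD('n) * (\<Prod>i\<in>UNIV. std_normal_density (?y $ i))"
      by (simp add: prod.distrib)
    finally have "gaussian_density C x = K * (\<Prod>i\<in>UNIV. std_normal_density (?y $ i))"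
      by (simp add: gaussian_density_def K_def)
    moreover have "std_normal_vec_density ?y = ennreal (\<Prod>i\<in>UNIV. std_normal_density (?y $ i))"
      unfolding std_normal_vec_density_def by (rule prod_ennreal) simp
    ultimately show ?thesis by (simp add: ennreal_mult'' prod_nonneg)
  qed
  thus ?thesis by (rule that)
qed

lemma nn_integral_std_normal_vec_density:
  "(\<integral>\<^sup>+y. std_normal_vec_density y \<partial>(lborel :: (real^'n) measure)) = 1"
proof -
  let ?D = "density (lborel :: (real^'n) measure) std_normal_vec_density"
  have comp: "(\<lambda>(y::real^'n) i. y $ i) \<in> ?D \<rightarrow>\<^sub>M (\<Pi>\<^sub>M i\<in>UNIV. borel)"
    by measurable
  have "prob_space (\<Pi>\<^sub>M i\<in>(UNIV :: 'n set). std_normal_measure)"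
    by (intro prob_space_PiM prob_space_std_normal_measure)
  hence "prob_space (distr ?D (\<Pi>\<^sub>M i\<in>UNIV. borel) (\<lambda>y i. y $ i))"
    by (simp add: distr_std_normal_vec_components)
  hence "prob_space ?D" by (rule prob_space_distrD[OF comp])
  hence "emeasure ?D (space ?D) = 1" by (rule prob_space.emeasure_space_1)
  thus ?thesis by (simp add: emeasure_density)
qed

text \<open>The law of \<open>A X\<close> has a density proportional to the standard normal one, since a Gaussian density
  is a multiple of the standard density after \<open>A\<close> and \<open>A\<close> changes Lebesgue measure by a factor.
  Both measures have mass one, so the proportionality factor is one.\<close>

lemma distr_gaussian_whitening:
  fixes X :: "'a \<Rightarrow> real^'n" and A C :: "real^'n^'n"
  assumes M: "prob_space M" and X: "gaussian_distributed M X C"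
    and A: "A ** C ** transpose A = mat 1"
  shows "distr M borel (\<lambda>\<omega>. A *v X \<omega>) = density lborel std_normal_vec_density"
proof -
  interpret prob_space M by fact
  let ?h = "std_normal_vec_density :: real^'n \<Rightarrow> ennreal"
  have AB: "A ** (C ** transpose A) = mat 1" using A by (simp add: matrix_mul_assoc)
  have D: "distributed M lborel X (\<lambda>x. ennreal (gaussian_density C x))"
    using X by (simp add: gaussian_distributed_def)
  obtain k where k: "\<And>x. ennreal (gaussian_density C x) = k * ?h (A *v x)"
    using gaussian_density_whitening[OF A] by blast
  have Xmea[measurable]: "X \<in> borel_measurable M"
    using distributed_measurable[OF D] by simp
  have law: "emeasure M ((\<lambda>\<omega>. A *v X \<omega>) -` S \<inter> space M)
      = k * (\<integral>\<^sup>+x. ?h (A *v x) \<partial>lborel) * emeasure (density lborel ?h) S"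
    if S[measurable]: "S \<in> sets borel" for S
  proof -
    have pre: "(*v) A -` S \<in> sets borel" using measurable_sets[OF borel_measurable_matrix_vector_mult[of A] S] by simp
    have "(\<lambda>\<omega>. A *v X \<omega>) -` S \<inter> space M = X -` ((*v) A -` S) \<inter> space M" by auto
    hence "emeasure M ((\<lambda>\<omega>. A *v X \<omega>) -` S \<inter> space M)
        = (\<integral>\<^sup>+x. ennreal (gaussian_density C x) * indicator ((*v) A -` S) x \<partial>lborel)"
      using distributed_emeasure[OF D, of "(*v) A -` S"] pre by simp
    also have "\<dots> = (\<integral>\<^sup>+x. k * (?h (A *v x) * indicator S (A *v x)) \<partial>lborel)"
      by (simp add: k mult.assoc indicator_def)
    also have "\<dots> = k * (\<integral>\<^sup>+x. ?h (A *v x) * indicator S (A *v x) \<partial>lborel)"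
      by (rule nn_integral_cmult) measurable
    also have "(\<integral>\<^sup>+x. ?h (A *v x) * indicator S (A *v x) \<partial>lborel)
        = (\<integral>\<^sup>+y. ?h y * indicator S y \<partial>lborel) * (\<integral>\<^sup>+x. ?h (A *v x) \<partial>lborel)"
      using nn_integral_linear_substitution_proportional[OF AB, of "\<lambda>y. ?h y * indicator S y" ?h]
      by (simp add: nn_integral_std_normal_vec_density)
    also have "(\<integral>\<^sup>+y. ?h y * indicator S y \<partial>lborel) = emeasure (density lborel ?h) S"
      by (simp add: emeasure_density)
    finally show ?thesis by (simp add: mult_ac)
  qed
  have "emeasure (density lborel ?h) UNIV = 1"
    by (simp add: emeasure_density nn_integral_std_normal_vec_density)
  \<comment> \<open>the case \<open>S = UNIV\<close> determines the factor\<close>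
  hence "k * (\<integral>\<^sup>+x. ?h (A *v x) \<partial>lborel) = 1"
    using law[of UNIV] emeasure_space_1 by simp
  with law show ?thesis
    by (intro measure_eqI) (auto simp: emeasure_distr)
qed

text \<open>These coordinates are some of the components of the whitened vector \<open>A X\<close>, and a subfamily of a
  product measure is again a product.\<close>

lemma distr_gaussian_conjugate_coordinates:
  fixes X :: "'a \<Rightarrow> real^'n" and a :: "'i \<Rightarrow> real^'n"
  assumes M: "prob_space M" and X: "gaussian_distributed M X C" and C: "spd C" and I: "finite I"
    and a: "\<And>i j. i \<in> I \<Longrightarrow> j \<in> I \<Longrightarrow> a i \<bullet> (C *v a j) = (if i = j then 1 else 0)"
  shows "distr M (\<Pi>\<^sub>M i\<in>I. borel) (\<lambda>\<omega>. \<lambda>i\<in>I. a i \<bullet> X \<omega>) = (\<Pi>\<^sub>M i\<in>I. std_normal_measure)"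
proof -
  obtain A :: "real^'n^'n" and \<tau> :: "'i \<Rightarrow> 'n" where
    A: "A ** C ** transpose A = mat 1" and \<tau>: "inj_on \<tau> I" "\<And>i. i \<in> I \<Longrightarrow> A $ \<tau> i = a i"
    using whitening_matrix_exists[OF C I a] by metis
  have Xmea[measurable]: "X \<in> borel_measurable M"
    using X unfolding gaussian_distributed_def by (auto dest: distributed_measurable)
  have [measurable]: "(\<lambda>f. \<lambda>i\<in>I. f (\<tau> i)) \<in> (\<Pi>\<^sub>M i\<in>UNIV. borel) \<rightarrow>\<^sub>M (\<Pi>\<^sub>M i\<in>I. (borel :: real measure))"
    by (rule measurable_restrict) auto
  have "(\<lambda>\<omega>. \<lambda>i\<in>I. a i \<bullet> X \<omega>)
      = (\<lambda>f. \<lambda>i\<in>I. f (\<tau> i)) \<circ> ((\<lambda>(y::real^'n) i. y $ i) \<circ> (\<lambda>\<omega>. A *v X \<omega>))"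
    using \<tau>(2) by (auto simp: fun_eq_iff matrix_vector_mul_component)
  hence "distr M (\<Pi>\<^sub>M i\<in>I. borel) (\<lambda>\<omega>. \<lambda>i\<in>I. a i \<bullet> X \<omega>)
      = distr (distr (distr M borel (\<lambda>\<omega>. A *v X \<omega>)) (\<Pi>\<^sub>M i\<in>UNIV. borel) (\<lambda>y i. y $ i))
          (\<Pi>\<^sub>M i\<in>I. borel) (\<lambda>f. \<lambda>i\<in>I. f (\<tau> i))"
    by (simp add: distr_distr)
  also have "\<dots> = distr (\<Pi>\<^sub>M i\<in>UNIV. std_normal_measure) (\<Pi>\<^sub>M i\<in>I. borel) (\<lambda>f. \<lambda>i\<in>I. f (\<tau> i))"
    by (simp add: distr_gaussian_whitening[OF M X A] distr_std_normal_vec_components)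
  also have "\<dots> = distr (\<Pi>\<^sub>M i\<in>UNIV. std_normal_measure) (\<Pi>\<^sub>M i\<in>I. std_normal_measure) (\<lambda>f. \<lambda>i\<in>I. f (\<tau> i))"
    by (rule distr_cong) (auto cong: sets_PiM_cong)
  also have "\<dots> = (\<Pi>\<^sub>M i\<in>I. std_normal_measure)"
    by (rule distr_PiM_reindex) (use \<tau> prob_space_std_normal_measure in auto)
  finally show ?thesis .
qed

section \<open>Closed forms of the two samples\<close>

lemma sum_UNIV_prod:
  fixes f :: "'a::finite \<times> 'b::finite \<Rightarrow> real"
  shows "(\<Sum>p\<in>UNIV. f p) = (\<Sum>i\<in>UNIV. \<Sum>j\<in>UNIV. f (i, j))"
  by (simp add: UNIV_Times_UNIV[symmetric] sum.cartesian_product del: UNIV_Times_UNIV)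

lemma discrepancy_matrix_mult_stack:
  fixes Mz :: "real^'n^'n" and u x :: "real^'m"
  shows "discrepancy_matrix Mz z *v stack x (kron_col_col u y) = x + (z \<bullet> (Mz *v y)) *\<^sub>R u"
proof -
  have "(discrepancy_matrix Mz z *v stack x (kron_col_col u y)) $ i = x $ i + (z \<bullet> (Mz *v y)) * u $ i"
    for i
  proof -
    have "(discrepancy_matrix Mz z *v stack x (kron_col_col u y)) $ i
        = (\<Sum>a\<in>UNIV. (if i = a then 1 else 0) * x $ a)
          + (\<Sum>j\<in>UNIV. \<Sum>l\<in>UNIV. (if i = j then 1 else 0) * (z v* Mz) $ l * (u $ j * y $ l))"
      by (simp add: discrepancy_matrix_def hblock_def stack_def kron_mat_row_def kron_def
          rowvector_def columnvector_def kron_col_col_def matrix_vector_mult_def sum_UNIV_Plus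
          sum_UNIV_prod mat_def)
    also have "(\<Sum>j\<in>UNIV. \<Sum>l\<in>UNIV. (if i = j then 1 else 0) * (z v* Mz) $ l * (u $ j * y $ l))
        = (\<Sum>j\<in>UNIV. if i = j then u $ j * ((z v* Mz) \<bullet> y) else 0)"
      by (rule sum.cong) (auto simp: inner_vec_def sum_distrib_left mult_ac)
    also have "(\<Sum>a\<in>UNIV. (if i = a then 1 else 0) * x $ a) = (\<Sum>a\<in>UNIV. if i = a then x $ a else 0)"
      by (rule sum.cong) auto
    finally show ?thesis by (simp add: dot_lmul_matrix mult.commute)
  qed
  thus ?thesis by (simp add: vec_eq_iff)
qed

lemma hblock_kron_row_mat_mult_stack:
  fixes Mz :: "real^'n^'n" and g u x :: "real^'m"
  shows "hblock 0 (kron_row_mat g Mz) *v stack x (kron_col_col u y) = (g \<bullet> u) *\<^sub>R (Mz *v y)"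
  by (simp add: vec_eq_iff hblock_def stack_def kron_row_mat_def kron_def rowvector_def
        columnvector_def kron_col_col_def matrix_vector_mult_def sum_UNIV_Plus sum_UNIV_prod
        inner_vec_def sum_product mult_ac)

text \<open>The weights \<open>- zt \<bullet> R zb\<^sub>k\<close> are exactly what cancels the discrepancy contribution of the Kronecker
  part, so the discrepancy matrix maps every summand to zero; in the remaining term
  the matrix \<open>Mz\<close> cancels against its inverse.\<close>

lemma mixed_hessian_mult_theta_sample:
  fixes Mz R :: "real^'n^'n" and L :: "real^'m^'n"
  assumes Mz: "pos_def Mz"
  shows "(L ** discrepancy_matrix Mz zt + hblock 0 (kron_row_mat g Mz)) *v theta_sample Mz R zt K zb ub
       = (\<Sum>k = 1..K. (g \<bullet> ub k) *\<^sub>R (R *v zb k))"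
proof -
  let ?B = "L ** discrepancy_matrix Mz zt + hblock 0 (kron_row_mat g Mz)"
  have *: "?B *v stack ((- (zt \<bullet> (R *v zb k))) *\<^sub>R ub k)
            (kron_col_col (ub k) (matrix_inv Mz *v (R *v zb k))) = (g \<bullet> ub k) *\<^sub>R (R *v zb k)" for k
  proof -
    have y: "Mz *v (matrix_inv Mz *v (R *v zb k)) = R *v zb k"
      by (simp add: matrix_vector_mul_assoc matrix_mul_assoc pos_def_matrix_inv[OF Mz])
    show ?thesis
      by (simp add: matrix_vector_mult_add_rdistrib matrix_vector_mul_assoc[symmetric]
          discrepancy_matrix_mult_stack hblock_kron_row_mat_mult_stack y)
  qed
  show ?thesis
    unfolding theta_sample_def Let_def linear_sum[OF matrix_vector_mul_linear] * ..
qed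

text \<open>For \<open>N = 1\<close> the vectors \<open>zb\<^sub>k\<close> are a full orthonormal basis and the projection is the identity, so
  that case needs the plain basis expansion. For \<open>N \<ge> 2\<close>, linear independence gives both \<open>N \<le> CARD('n)\<close>,
  which makes the truncated difference \<open>CARD('n) - N + 1\<close> the codimension of the \<open>N - 1\<close> columns
  of \<open>Zc\<close>, and the injectivity of \<open>Zc\<close>.\<close>

lemma Gamma_matrix_mult:
  fixes Wz R :: "real^'n^'n" and Wu :: "real^'m^'m" and z zb :: "nat \<Rightarrow> real^'n"
    and col :: "'k::finite \<Rightarrow> nat" and Zc :: "real^'k^'n"
  assumes R: "spd R" "R ** R = matrix_inv Wz"
    and N: "N \<ge> 1"
    and z: "inj_on z {1..N}" "independent (z ` {1..N})"
    and col: "N \<ge> 2 \<Longrightarrow> bij_betw col UNIV {2..N}"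
    and Zc: "Zc = (\<chi> i k. (z (col k) - z 1) $ i)"
    and b: "\<And>k l. k \<in> {1..CARD('n) - N + 1} \<Longrightarrow> l \<in> {1..CARD('n) - N + 1} \<Longrightarrow>
           zb k \<bullet> zb l = (if k = l then 1 else 0)"
    and bz: "\<And>k l. k \<in> {1..CARD('n) - N + 1} \<Longrightarrow> l \<in> {2..N} \<Longrightarrow> zb k \<bullet> (R *v (z l - z 1)) = 0"
  shows "Gamma_matrix N g Wu Wz Zc *v x
       = (\<Sum>k = 1..CARD('n) - N + 1.
            (sqrt (g \<bullet> (matrix_inv Wu *v g)) * ((matrix_inv R *v zb k) \<bullet> x)) *\<^sub>R (R *v zb k))"
proof -
  let ?I = "{1..CARD('n) - N + 1}" and ?a = "\<lambda>k. matrix_inv R *v zb k"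
  have RT: "transpose R = R" and Rpd: "pos_def R" using R(1) by (auto simp: spd_def)
  have RiT: "transpose (matrix_inv R) = matrix_inv R"
    using spd_matrix_inv[OF R(1)] by (simp add: spd_def)
  have P: "(if N = 1 then mat 1 else mat 1 - matrix_inv Wz ** Zc **
             matrix_inv (transpose Zc ** matrix_inv Wz ** Zc) ** transpose Zc) *v x
        = (\<Sum>k\<in>?I. (?a k \<bullet> x) *\<^sub>R (R *v zb k))"
  proof (cases "N = 1")
    case True
    have "x = R *v (matrix_inv R *v x)"
      by (simp add: matrix_vector_mul_assoc pos_def_matrix_inv[OF Rpd])
    also have "matrix_inv R *v x = (\<Sum>k\<in>?I. (zb k \<bullet> (matrix_inv R *v x)) *\<^sub>R zb k)"
      by (rule orthonormal_basis_expansion) (use b True in auto)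
    also have "R *v \<dots> = (\<Sum>k\<in>?I. (?a k \<bullet> x) *\<^sub>R (R *v zb k))"
      unfolding linear_sum[OF matrix_vector_mul_linear]
      by (rule sum.cong) (simp_all add: matrix_vector_mult_scaleR inner_matrix_vector_mult_left RiT)
    finally show ?thesis using True by simp
  next
    case False
    with N have N2: "N \<ge> 2" by simp
    have cb: "bij_betw col UNIV {2..N}" by (rule col[OF N2])
    have "card (z ` {1..N}) \<le> DIM(real^'n)" using independent_card_le z(2) by blast
    hence "N \<le> CARD('n)" using card_image[OF z(1)] by simp
    moreover have "CARD('k) = N - 1" using bij_betw_same_card[OF cb] by simp
    ultimately have card: "card ?I + CARD('k) = CARD('n)" using N2 by simp
    have orth: "transpose Zc *v (R *v zb k) = 0" if k: "k \<in> ?I" for k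
    proof -
      have "(transpose Zc *v (R *v zb k)) $ j = 0" for j
      proof -
        have "col j \<in> {2..N}" using cb by (auto simp: bij_betw_def)
        hence "0 = (R *v (z (col j) - z 1)) \<bullet> zb k" using bz[OF k] by (simp add: inner_commute)
        also have "\<dots> = (z (col j) - z 1) \<bullet> (R *v zb k)"
          by (simp only: inner_matrix_vector_mult_left RT)
        also have "\<dots> = (transpose Zc *v (R *v zb k)) $ j"
          by (simp add: Zc transpose_def matrix_vector_mul_component inner_vec_def)
        finally show ?thesis by simp
      qed
      thus ?thesis by (simp add: vec_eq_iff)
    qed
    have "(mat 1 - (R ** R) ** Zc ** matrix_inv (transpose Zc ** (R ** R) ** Zc) ** transpose Zc) *v x
        = (\<Sum>k\<in>?I. (?a k \<bullet> x) *\<^sub>R (R *v zb k))"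
      by (rule oblique_projection_expansion[OF R(1) difference_matrix_injective[OF z cb Zc] _ card b orth]) auto
    thus ?thesis using False R(2) by simp
  qed
  show ?thesis
    unfolding Gamma_matrix_def scaleR_matrix_vector_assoc[symmetric] P
    by (simp only: scaleR_sum_right scaleR_scaleR)
qed

theorem theorem4p4:
  fixes Mz Wz R :: "real^'n^'n"
    and Wu :: "real^'m^'m"
    and J :: "real^'m \<Rightarrow> real^'n \<Rightarrow> real"
    and S :: "real^'n \<Rightarrow> real^'m"
    and zt :: "real^'n"
    and N :: nat
    and z zb :: "nat \<Rightarrow> real^'n"
    and col :: "'k::finite \<Rightarrow> nat"
    and Zc :: "real^'k^'n"
    and \<Omega> :: "'a measure"
    and ub :: "nat \<Rightarrow> 'a \<Rightarrow> real^'m"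
    and \<Omega>' :: "'b measure"
    and \<nu> :: "'b \<Rightarrow> real^'n"
    and B :: "real^('m + 'm \<times> 'n)^'n"
    and \<Gamma> :: "real^'n^'n"
  assumes spd: "spd Mz" "spd Wu" "spd Wz"
    and sqrt_Wz_inv: "spd R" "R ** R = matrix_inv Wz"
    and C2: "twice_continuously_differentiable (\<lambda>(z, \<theta>). reduced_objective J S Mz z \<theta>)"
    and diff_S: "S differentiable (at zt)"
    and diff_J: "\<And>u z. (\<lambda>u'. J u' z) differentiable (at u)"
    and diff_grad_u: "\<And>u z. (\<lambda>u'. grad_u J u' z) differentiable (at u)"
    and diff_grad_z: "\<And>u z. (\<lambda>z'. grad_u J u z') differentiable (at z)"
    and mixed_J_zero: "\<And>u z. mixed_hessian (\<lambda>z' u'. J u' z') z u = 0"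
    and local_min: "\<forall>\<^sub>F y in nhds zt. reduced_objective J S Mz zt 0 \<le> reduced_objective J S Mz y 0"
    and grad_zero: "gradient (\<lambda>z. reduced_objective J S Mz z 0) zt = 0"
    and hessian_pos_def: "pos_def (hessian (\<lambda>z. reduced_objective J S Mz z 0) zt)"
    and B: "B = mixed_hessian (reduced_objective J S Mz) zt 0"
    and N: "N \<ge> 1"
    and lin_indep: "inj_on z {1..N}" "independent (z ` {1..N})"
    and z_1: "z 1 = zt"
    and col: "N \<ge> 2 \<Longrightarrow> bij_betw col UNIV {2..N}"
    and Zc: "Zc = (\<chi> i k. (z (col k) - zt) $ i)"
    and orthonormal: "\<And>k l. k \<in> {1..CARD('n) - N + 1} \<Longrightarrow> l \<in> {1..CARD('n) - N + 1} \<Longrightarrow>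
           zb k \<bullet> zb l = (if k = l then 1 else 0)"
    and orthogonal: "\<And>k l. k \<in> {1..CARD('n) - N + 1} \<Longrightarrow> l \<in> {2..N} \<Longrightarrow>
           zb k \<bullet> (R *v (z l - zt)) = 0"
    and prob: "prob_space \<Omega>" "prob_space \<Omega>'"
    and u_indep: "prob_space.indep_vars \<Omega> (\<lambda>_. borel) ub {1..CARD('n) - N + 1}"
    and u_gaussian: "\<And>k. k \<in> {1..CARD('n) - N + 1} \<Longrightarrow>
           gaussian_distributed \<Omega> (ub k) (matrix_inv Wu)"
    and nu_gaussian: "gaussian_distributed \<Omega>' \<nu> (matrix_inv Wz)"
    and Gamma: "\<Gamma> = Gamma_matrix N (grad_u J (S zt) zt) Wu Wz Zc"
  shows "distr \<Omega> borel (\<lambda>\<omega>. B *v theta_sample Mz R zt (CARD('n) - N + 1) zb (\<lambda>k. ub k \<omega>))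
       = distr \<Omega>' borel (\<lambda>\<omega>. \<Gamma> *v \<nu> \<omega>)"
proof -
  interpret \<Omega>: prob_space \<Omega> by (rule prob(1))
  interpret \<Omega>': prob_space \<Omega>' by (rule prob(2))
  define K where "K = CARD('n) - N + 1"
  define g where "g = grad_u J (S zt) zt"
  define c where "c = sqrt (g \<bullet> (matrix_inv Wu *v g))"
  define a where "a k = matrix_inv R *v zb k" for k
  have B_theta: "B *v theta_sample Mz R zt K zb u = (\<Sum>k = 1..K. (g \<bullet> u k) *\<^sub>R (R *v zb k))" for u
    unfolding B mixed_hessian_reduced_objective[OF C2 diff_S mixed_J_zero] g_def
    by (rule mixed_hessian_mult_theta_sample) (use spd(1) in \<open>simp add: spd_def\<close>)
  have Gamma_nu: "\<Gamma> *v x = (\<Sum>k = 1..K. (c * (a k \<bullet> x)) *\<^sub>R (R *v zb k))" for x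
    unfolding Gamma K_def c_def a_def g_def
    by (rule Gamma_matrix_mult[OF sqrt_Wz_inv N lin_indep col])
       (use orthonormal orthogonal Zc z_1 in auto)
  show ?thesis
  \<comment> \<open>if \<open>g = 0\<close> then \<open>c = 0\<close>, and the normalized vector \<open>g / c\<close> below is not available\<close>
  proof (cases "g = 0")
    case True
    thus ?thesis unfolding K_def[symmetric] by (simp add: B_theta Gamma_nu c_def)
  next
    case False
    have Wui: "spd (matrix_inv Wu)" and Wzi: "spd (matrix_inv Wz)"
      using spd by (auto intro: spd_matrix_inv)
    have c2: "g \<bullet> (matrix_inv Wu *v g) = c\<^sup>2" and c: "c > 0"
      using Wui False by (auto simp: c_def spd_def pos_def_def less_imp_le)
    \<comment> \<open>the linear map that produces both random vectors from standard normal coefficients\<close>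
    define F :: "(nat \<Rightarrow> real) \<Rightarrow> real^'n"
      where "F f = (\<Sum>k = 1..K. (c * f k) *\<^sub>R (R *v zb k))" for f
    have F [measurable]: "F \<in> borel_measurable (\<Pi>\<^sub>M k\<in>{1..K}. borel)"
      unfolding F_def by measurable
    have F_restrict: "F (\<lambda>k\<in>{1..K}. f k) = F f" for f
      unfolding F_def by (rule sum.cong) auto
    have [measurable]: "\<nu> \<in> borel_measurable \<Omega>'"
      using nu_gaussian unfolding gaussian_distributed_def by (auto dest: distributed_measurable)
    have ub [measurable]: "ub k \<in> borel_measurable \<Omega>" if "k \<in> {1..K}" for k
      using u_gaussian[of k] that unfolding K_def gaussian_distributed_def
      by (auto dest: distributed_measurable)
    let ?v = "(1 / c) *\<^sub>R g"
    have v: "?v \<bullet> (matrix_inv Wu *v ?v) = 1"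
      using c c2 by (simp add: matrix_vector_mult_scaleR power2_eq_square)
    \<comment> \<open>\<open>?v\<close> is a unit vector for the covariance, so the one-element family has a product law with a single factor\<close>
    have v_law: "distr \<Omega> borel (\<lambda>\<omega>. ?v \<bullet> ub k \<omega>) = std_normal_measure" if k: "k \<in> {1..K}" for k
    proof -
      note [measurable] = ub[OF k]
      have "distr \<Omega> borel (\<lambda>\<omega>. ?v \<bullet> ub k \<omega>)
          = distr (distr \<Omega> (\<Pi>\<^sub>M i\<in>{()}. borel) (\<lambda>\<omega>. \<lambda>i\<in>{()}. ?v \<bullet> ub k \<omega>)) borel (\<lambda>f. f ())"
        by (subst distr_distr) (auto simp: o_def)
      also have "distr \<Omega> (\<Pi>\<^sub>M i\<in>{()}. borel) (\<lambda>\<omega>. \<lambda>i\<in>{()}. ?v \<bullet> ub k \<omega>) = (\<Pi>\<^sub>M i\<in>{()}. std_normal_measure)"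
        by (rule distr_gaussian_conjugate_coordinates[OF prob(1) u_gaussian Wui])
           (use k v in \<open>auto simp: K_def\<close>)
      also have "distr (\<Pi>\<^sub>M i\<in>{()}. std_normal_measure) borel (\<lambda>f. f ())
          = distr (\<Pi>\<^sub>M i\<in>{()}. std_normal_measure) std_normal_measure (\<lambda>f. f ())"
        by (rule distr_cong) auto
      also have "\<dots> = std_normal_measure"
        by (rule distr_PiM_component) (auto simp: prob_space_std_normal_measure)
      finally show ?thesis .
    qed
    have "\<Omega>.indep_vars (\<lambda>_. borel) (\<lambda>k \<omega>. ?v \<bullet> ub k \<omega>) {1..K}"
      using \<Omega>.indep_vars_compose2[OF u_indep[folded K_def], of "\<lambda>_ u. ?v \<bullet> u" "\<lambda>_. borel"] by simp
    moreover have "{1..K} \<noteq> {}" by (simp add: K_def)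
    ultimately have "distr \<Omega> (\<Pi>\<^sub>M k\<in>{1..K}. borel) (\<lambda>\<omega>. \<lambda>k\<in>{1..K}. ?v \<bullet> ub k \<omega>)
        = (\<Pi>\<^sub>M k\<in>{1..K}. distr \<Omega> borel (\<lambda>\<omega>. ?v \<bullet> ub k \<omega>))"
      by (subst (asm) \<Omega>.indep_vars_iff_distr_eq_PiM') (auto simp: ub)
    also have "\<dots> = (\<Pi>\<^sub>M k\<in>{1..K}. std_normal_measure)"
      by (rule PiM_cong[OF refl v_law])
    finally have left: "distr \<Omega> (\<Pi>\<^sub>M k\<in>{1..K}. borel) (\<lambda>\<omega>. \<lambda>k\<in>{1..K}. ?v \<bullet> ub k \<omega>)
        = (\<Pi>\<^sub>M k\<in>{1..K}. std_normal_measure)" .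
    \<comment> \<open>the vectors \<open>a k\<close> inherit orthonormality from \<open>zb\<close>, since \<open>R\<^sup>-\<^sup>1 (R R) R\<^sup>-\<^sup>1 = I\<close>\<close>
    have right: "distr \<Omega>' (\<Pi>\<^sub>M k\<in>{1..K}. borel) (\<lambda>\<omega>. \<lambda>k\<in>{1..K}. a k \<bullet> \<nu> \<omega>)
        = (\<Pi>\<^sub>M k\<in>{1..K}. std_normal_measure)"
    proof (rule distr_gaussian_conjugate_coordinates[OF prob(2) nu_gaussian Wzi])
      have Rpd: "pos_def R" and RiT: "transpose (matrix_inv R) = matrix_inv R"
        using sqrt_Wz_inv(1) spd_matrix_inv[OF sqrt_Wz_inv(1)] by (auto simp: spd_def)
      fix i j assume ij: "i \<in> {1..K}" "j \<in> {1..K}"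
      have "matrix_inv R ** ((R ** R) ** matrix_inv R) = (matrix_inv R ** R) ** (R ** matrix_inv R)"
        by (simp only: matrix_mul_assoc)
      also have "\<dots> = mat 1" by (simp add: pos_def_matrix_inv[OF Rpd])
      finally have "matrix_inv R *v (matrix_inv Wz *v (matrix_inv R *v zb j)) = zb j"
        by (simp add: sqrt_Wz_inv(2)[symmetric] matrix_vector_mul_assoc)
      hence "a i \<bullet> (matrix_inv Wz *v a j) = zb i \<bullet> zb j"
        by (simp add: a_def inner_matrix_vector_mult_left RiT)
      thus "a i \<bullet> (matrix_inv Wz *v a j) = (if i = j then 1 else 0)"
        using orthonormal[of i j] ij by (simp add: K_def)
    qed simp
    have "distr \<Omega> borel (\<lambda>\<omega>. B *v theta_sample Mz R zt K zb (\<lambda>k. ub k \<omega>))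
        = distr \<Omega> borel (\<lambda>\<omega>. F (\<lambda>k\<in>{1..K}. ?v \<bullet> ub k \<omega>))"
      using c by (simp only: F_restrict) (simp add: B_theta F_def)
    also have "\<dots> = distr (distr \<Omega> (\<Pi>\<^sub>M k\<in>{1..K}. borel) (\<lambda>\<omega>. \<lambda>k\<in>{1..K}. ?v \<bullet> ub k \<omega>)) borel F"
      by (subst distr_distr[OF F]) (auto simp: o_def intro!: measurable_restrict)
    also have "\<dots> = distr (distr \<Omega>' (\<Pi>\<^sub>M k\<in>{1..K}. borel) (\<lambda>\<omega>. \<lambda>k\<in>{1..K}. a k \<bullet> \<nu> \<omega>)) borel F"
      by (simp only: left right)
    also have "\<dots> = distr \<Omega>' borel (\<lambda>\<omega>. F (\<lambda>k\<in>{1..K}. a k \<bullet> \<nu> \<omega>))"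
      by (subst distr_distr[OF F]) (auto simp: o_def intro!: measurable_restrict)
    also have "\<dots> = distr \<Omega>' borel (\<lambda>\<omega>. \<Gamma> *v \<nu> \<omega>)"
      by (simp only: F_restrict) (simp add: F_def Gamma_nu)
    finally show ?thesis by (simp only: K_def)
  qed
qed

end
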